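(* Let $M\in\mathbb{R}^{n\times n}$ be a symmetric positive definite matrix with eigenvalues $\lambda_1\ge\lambda_2\ge\cdots\ge\lambda_n>0$, let $1\le r<p\le n-1$, and let $\widehat{M}$ be a maximal volume pseudo skeleton approximation of $M$ with parameters $p=q$. Let $\widehat{M}_r:=(\widehat{M})_r$ be the approximation of $\widehat{M}$ given by its $r$-truncated singular value decomposition. Then $$\left\|\widehat{M}_r-M\right\|_C\le\left(\zeta_p(M)\,\frac{\lambda_{p+1}}{\lambda_{r+1}}+1\right)\lambda_{r+1}$$ and $\operatorname{rank}(\widehat{M}_r)=r$.
   Context: Chebyshev norm: $\|X\|_C=\max_{i,j}|X_{i,j}|$. Pseudo skeleton approximation: let $M\in\mathbb{R}^{m\times n}$ and let $P_1\in\mathbb{R}^{m\times m}$, $P_2\in\mathbb{R}^{n\times n}$ be permutation matrices with $P_1MP_2^T=\begin{bmatrix}A&B\\C&D\end{bmatrix}$, $A\in\mathbb{R}^{p\times q}$. With $A^+$ the Moore-Penrose inverse of $A$, the matrix $\widehat{M}=P_1^T\begin{bmatrix}A\\C\end{bmatrix}A^+\begin{bmatrix}A&B\end{bmatrix}P_2$ is called a pseudo skeleton approximation of $M$ with parameters $p,q$. It is called a maximal volume approximation if $P_1,P_2$ are chosen (among all pairs of permutations) so that $\rho=\operatorname{rank}(A)$ is maximal and, subject to this, the $\rho$-volume $\operatorname{vol}_\rho(A)=\sigma_1(A)\cdots\sigma_\rho(A)$ is maximal, where $\sigma_1(A)\ge\sigma_2(A)\ge\cdots$ are the singular values of $A$.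 For symmetric positive definite $M\in\mathbb{R}^{n\times n}$ and $p=q$, the standing convention is that $A$ is a principal submatrix of $M$ with maximal volume, i.e. $P_1=P_2$. For a matrix $X$, the $r$-truncated singular value decomposition approximation $(X)_r$ is obtained from a singular value decomposition of $X$ (singular values in decreasing order) by replacing all singular values $\sigma_{r+1},\sigma_{r+2},\ldots$ by zero. For a symmetric matrix $M$ whose eigenvalues in decreasing order are $\lambda_1\ge\lambda_2\ge\cdots$ with $\lambda_{p+1}>0$, define $\zeta_p(M)=H(\lambda_1,\ldots,\lambda_{p+1})/\lambda_{p+1}$, where $H(\lambda_1,\ldots,\lambda_{p+1})=\dfrac{p+1}{\lambda_1^{-1}+\cdots+\lambda_{p+1}^{-1}}$ is the harmonic mean. *)

theory Defs
  imports
    "HOL-Combinatorics.Permutations"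
    "HOL-Computational_Algebra.Polynomial"
    "Jordan_Normal_Form.Char_Poly"
    "Jordan_Normal_Form.DL_Rank"
begin

section \<open>Basic matrix notions\<close>

definition chebyshev_norm :: "real mat \<Rightarrow> real" where
  "chebyshev_norm X = Max (abs ` elements_mat X)"

definition mat_rank :: "real mat \<Rightarrow> nat" where
  "mat_rank X = vec_space.rank (dim_row X) X"

definition symmetric_mat :: "real mat \<Rightarrow> bool" where
  "symmetric_mat M \<longleftrightarrow> square_mat M \<and> transpose_mat M = M"

definition pos_def_mat :: "real mat \<Rightarrow> bool" where
  "pos_def_mat M \<longleftrightarrow>
     (\<forall>v \<in> carrier_vec (dim_row M). v \<noteq> 0\<^sub>v (dim_row M) \<longrightarrow> v \<bullet> (M *\<^sub>v v) > 0)"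

text \<open>Real matrices with orthonormal columns; the library's \<open>orthogonal_mat\<close>
  does not normalise the columns.\<close>

definition orthonormal_mat :: "nat \<Rightarrow> real mat \<Rightarrow> bool" where
  "orthonormal_mat n U \<longleftrightarrow> U \<in> carrier_mat n n \<and> transpose_mat U * U = 1\<^sub>m n"

definition permutation_mat :: "nat \<Rightarrow> real mat \<Rightarrow> bool" where
  "permutation_mat n P \<longleftrightarrow>
     (\<exists>\<pi>. \<pi> permutes {0..<n} \<and> P = mat n n (\<lambda>(i, j). if j = \<pi> i then 1 else 0))"

definition append_cols :: "real mat \<Rightarrow> real mat \<Rightarrow> real mat" where
  "append_cols A B = transpose_mat (transpose_mat A @\<^sub>r transpose_mat B)"

section \<open>Eigenvalues and the quantity \<open>\<zeta>\<close>\<close>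

text \<open>The real eigenvalues with algebraic multiplicity in decreasing order; for a symmetric
  matrix of dimension \<open>n\<close> this list has length \<open>n\<close>. In \<open>eigval\<close> the index starts at 1.\<close>

definition eigvals_desc :: "real mat \<Rightarrow> real list" where
  "eigvals_desc M = rev (sorted_list_of_multiset (proots (char_poly M)))"

definition eigval :: "real mat \<Rightarrow> nat \<Rightarrow> real" where
  "eigval M i = eigvals_desc M ! (i - 1)"

definition zeta :: "nat \<Rightarrow> real mat \<Rightarrow> real" where
  "zeta p M =
     (real (p + 1) / (\<Sum>i = 1..p + 1. inverse (eigval M i))) / eigval M (p + 1)"

section \<open>Singular values, truncated singular value decompositions, volume\<close>

text \<open>\<open>singval X i\<close> is \<open>\<sigma>\<^sub>i(X)\<close>, \<open>1 \<le> i \<le> min m n\<close> for an \<open>m \<times> n\<close> matrix \<open>X\<close>.\<close>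

definition singval :: "real mat \<Rightarrow> nat \<Rightarrow> real" where
  "singval X i = sqrt (eigval (transpose_mat X * X) i)"

definition rect_diag_mat :: "nat \<Rightarrow> nat \<Rightarrow> (nat \<Rightarrow> real) \<Rightarrow> real mat" where
  "rect_diag_mat m n d = mat m n (\<lambda>(i, j). if i = j then d (i + 1) else 0)"

definition is_svd :: "real mat \<Rightarrow> real mat \<Rightarrow> real mat \<Rightarrow> bool" where
  "is_svd X U V \<longleftrightarrow>
     orthonormal_mat (dim_row X) U \<and> orthonormal_mat (dim_col X) V \<and>
     X = U * rect_diag_mat (dim_row X) (dim_col X) (singval X) * transpose_mat V"

text \<open>A relation rather than a function: if \<open>\<sigma>\<^sub>r = \<sigma>\<^sub>r\<^sub>+\<^sub>1 > 0\<close>, the result depends on the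
  decomposition used.\<close>

definition is_truncated_svd :: "nat \<Rightarrow> real mat \<Rightarrow> real mat \<Rightarrow> bool" where
  "is_truncated_svd r X Y \<longleftrightarrow>
     (\<exists>U V. is_svd X U V \<and>
        Y = U * rect_diag_mat (dim_row X) (dim_col X) (\<lambda>i. if i \<le> r then singval X i else 0)
              * transpose_mat V)"

definition vol :: "nat \<Rightarrow> real mat \<Rightarrow> real" where
  "vol \<rho> X = (\<Prod>i = 1..\<rho>. singval X i)"

section \<open>Pseudo skeleton approximations\<close>

definition is_moore_penrose :: "real mat \<Rightarrow> real mat \<Rightarrow> bool" where
  "is_moore_penrose A X \<longleftrightarrow>
     X \<in> carrier_mat (dim_col A) (dim_row A) \<and>
     A * X * A = A \<and> X * A * X = X \<and>
     transpose_mat (A * X) = A * X \<and> transpose_mat (X * A) = X * A"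

definition moore_penrose :: "real mat \<Rightarrow> real mat" where
  "moore_penrose A = (THE X. is_moore_penrose A X)"

definition permuted_blocks ::
  "nat \<Rightarrow> nat \<Rightarrow> real mat \<Rightarrow> real mat \<Rightarrow> real mat \<Rightarrow>
     real mat \<times> real mat \<times> real mat \<times> real mat" where
  "permuted_blocks p q M P1 P2 = split_block (P1 * M * transpose_mat P2) p q"

definition lead_block :: "nat \<Rightarrow> nat \<Rightarrow> real mat \<Rightarrow> real mat \<Rightarrow> real mat \<Rightarrow> real mat" where
  "lead_block p q M P1 P2 = fst (permuted_blocks p q M P1 P2)"

definition pseudo_skeleton ::
  "nat \<Rightarrow> nat \<Rightarrow> real mat \<Rightarrow> real mat \<Rightarrow> real mat \<Rightarrow> real mat" where
  "pseudo_skeleton p q M P1 P2 =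
     (let (A, B, C, D) = permuted_blocks p q M P1 P2
      in transpose_mat P1 * (A @\<^sub>r C) * moore_penrose A * append_cols A B * P2)"

definition max_volume_perms ::
  "nat \<Rightarrow> nat \<Rightarrow> real mat \<Rightarrow> real mat \<Rightarrow> real mat \<Rightarrow> bool" where
  "max_volume_perms p q M P1 P2 \<longleftrightarrow>
     permutation_mat (dim_row M) P1 \<and> permutation_mat (dim_col M) P2 \<and>
     (let A = lead_block p q M P1 P2; \<rho> = mat_rank A in
      \<forall>Q1 Q2. permutation_mat (dim_row M) Q1 \<and> permutation_mat (dim_col M) Q2 \<longrightarrow>
        (let A' = lead_block p q M Q1 Q2 in
         mat_rank A' \<le> \<rho> \<and> (mat_rank A' = \<rho> \<longrightarrow> vol \<rho> A' \<le> vol \<rho> A)))"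

text \<open>For symmetric positive definite matrices the maximal volume submatrix is taken to be
  principal, which is the requirement that both permutations agree.\<close>

definition is_principal_max_volume_approx :: "nat \<Rightarrow> real mat \<Rightarrow> real mat \<Rightarrow> bool" where
  "is_principal_max_volume_approx p M Mh \<longleftrightarrow>
     (\<exists>P. max_volume_perms p p M P P \<and> Mh = pseudo_skeleton p p M P P)"

end

theory Submission
  imports Defs
begin

text \<open>Write \<open>A = J\<^sup>T M J\<close> for the chosen principal submatrix, with \<open>J\<close> a coordinate embedding.
  Then the skeleton approximation is \<open>S = M Q M\<close> with \<open>Q = J A\<^sup>-\<^sup>1 J\<^sup>T\<close>, and \<open>Q M Q = Q\<close> gives
  \<open>0 \<le> S \<le> M\<close> in the Loewner order. The error \<open>E = M - S\<close> is therefore positive semidefinite,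
  so its entries are bounded by its diagonal. A diagonal entry is at most the harmonic mean of the
  eigenvalues of a bordered submatrix of size \<open>p + 1\<close>, because \<open>det A\<close> is maximal, and hence, by
  interlacing, at most the harmonic mean of \<open>\<lambda>\<^sub>1, \<dots>, \<lambda>\<^sub>p\<^sub>+\<^sub>1\<close>. Truncation adds at most
  \<open>\<sigma>\<^sub>r\<^sub>+\<^sub>1(S) = \<lambda>\<^sub>r\<^sub>+\<^sub>1(S) \<le> \<lambda>\<^sub>r\<^sub>+\<^sub>1(M)\<close>, by Weyl monotonicity.\<close>

section \<open>The spectral theorem for real symmetric matrices\<close>

text \<open>The claimed bound is \<open>h + eigval M (r + 1)\<close>, where
  \<open>h = zeta p M * eigval M (p + 1)\<close> is the harmonic mean of the \<open>p + 1\<close>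
  largest eigenvalues; the summands are the skeleton error and the truncation error. The harmonic
  mean appears because a diagonal error entry is a Schur complement, the reciprocal of a diagonal
  entry of an inverse. Maximality lets that entry dominate the average of its diagonal, and the
  trace of an inverse is a sum of reciprocal eigenvalues. The rank claim rests on
  \<open>r < p\<close>: compressing \<open>S\<close> to the selected indices gives back
  \<open>A\<close>, so the first \<open>r\<close> eigenvalues of \<open>S\<close> are at least those
  of \<open>A\<close>, hence positive, and truncation keeps exactly \<open>r\<close> nonzero
  singular values. A singular value decomposition of \<open>S\<close> is not unique and its factors
  may differ from each other, so the truncation error is estimated for arbitrary orthogonal
  \<open>U\<close> and \<open>V\<close>. Since \<open>eigval\<close> reads a sorted list of
  polynomial roots, each inequality must first be tied to quadratic forms; the spectral theorem
  provides this link.\<close>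

lemma symmetric_eigenvalue_real:
  fixes A :: "real mat" and a :: complex
  assumes A: "A \<in> carrier_mat n n" and sym: "A\<^sup>T = A"
    and ev: "eigenvalue (map_mat of_real A) a"
  shows "a \<in> \<real>"
proof -
  let ?C = "map_mat of_real A :: complex mat"
  obtain v where v: "v \<in> carrier_vec n" "v \<noteq> 0\<^sub>v n" "?C *\<^sub>v v = a \<cdot>\<^sub>v v"
    using ev A unfolding eigenvalue_def eigenvector_def by auto
  have symA: "A $$ (j,i) = A $$ (i,j)" if "i < n" "j < n" for i j
    using that sym A by (metis carrier_matD index_transpose_mat(1))
  \<comment> \<open>The Hermitian form of \<open>A\<close> at \<open>v\<close>: the eigenvector
    equation makes it \<open>a\<close> times a positive real, and symmetry of \<open>A\<close> makes
    it equal to its conjugate.\<close>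
  define s where "s = (\<Sum>i<n. \<Sum>j<n. cnj (v $ i) * of_real (A $$ (i,j)) * v $ j)"
  have row: "(\<Sum>j<n. of_real (A $$ (i,j)) * v $ j) = a * v $ i" if "i < n" for i
    using arg_cong[OF v(3), of "\<lambda>w. w $ i"] that v(1) A
    by (simp add: scalar_prod_def atLeast0LessThan)
  have s1: "s = a * of_real (\<Sum>i<n. (cmod (v $ i))\<^sup>2)"
  proof -
    have "s = (\<Sum>i<n. cnj (v $ i) * (\<Sum>j<n. of_real (A $$ (i,j)) * v $ j))"
      unfolding s_def by (simp add: sum_distrib_left mult.assoc)
    also have "\<dots> = (\<Sum>i<n. cnj (v $ i) * (a * v $ i))" by (simp add: row)
    also have "\<dots> = (\<Sum>i<n. a * of_real ((cmod (v $ i))\<^sup>2))"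
      by (simp add: complex_norm_square mult_ac del: of_real_power)
    finally show ?thesis by (simp add: sum_distrib_left)
  qed
  have "cnj s = (\<Sum>i<n. \<Sum>j<n. v $ i * of_real (A $$ (i,j)) * cnj (v $ j))"
    unfolding s_def by simp
  also have "\<dots> = (\<Sum>j<n. \<Sum>i<n. v $ i * of_real (A $$ (i,j)) * cnj (v $ j))"
    by (rule sum.swap)
  also have "\<dots> = s"
    unfolding s_def by (intro sum.cong refl) (auto simp: symA mult_ac)
  finally have "s \<in> \<real>" by (simp add: Reals_cnj_iff)
  moreover have "(\<Sum>i<n. (cmod (v $ i))\<^sup>2) \<noteq> 0"
  proof -
    obtain k where "k < n" "v $ k \<noteq> 0" using v(1,2) by force
    then have "(\<Sum>i<n. (cmod (v $ i))\<^sup>2) > 0"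
      by (intro sum_pos2[of _ k]) auto
    then show ?thesis by simp
  qed
  ultimately show ?thesis unfolding s1
    by (metis Reals_divide Reals_of_real nonzero_mult_div_cancel_right of_real_eq_0_iff)
qed

text \<open>The complex factorization has only real roots, so it is the image of a real one, and
  injectivity of the coefficient embedding pulls the identity back.\<close>

lemma symmetric_char_poly_splits:
  fixes A :: "real mat"
  assumes A: "A \<in> carrier_mat n n" and sym: "A\<^sup>T = A"
  obtains es where "char_poly A = (\<Prod>e\<leftarrow>es. [:- e, 1:])"
proof -
  let ?C = "map_mat of_real A :: complex mat"
  have C: "?C \<in> carrier_mat n n" using A by simp
  obtain as where as: "char_poly ?C = (\<Prod>a\<leftarrow>as. [:- a, 1:])"
    using char_poly_factorized[OF C] by auto
  interpret h: map_poly_inj_comm_ring_hom "of_real :: real \<Rightarrow> complex"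
    by unfold_locales
  have "a \<in> \<real>" if "a \<in> set as" for a
  proof -
    have "poly (char_poly ?C) a = 0" unfolding as using that by (rule linear_poly_root)
    then show ?thesis
      using symmetric_eigenvalue_real[OF A sym] eigenvalue_root_char_poly[OF C] by blast
  qed
  then have re: "as = map of_real (map Re as)"
    by (induction as) auto
  have "map_poly of_real (char_poly A) = char_poly ?C"
    by (rule of_real_hom.char_poly_hom[OF A, symmetric])
  also have "\<dots> = (\<Prod>a\<leftarrow>map Re as. [:- of_real a, 1:])"
    unfolding as by (subst re) (simp add: o_def)
  also have "\<dots> = map_poly of_real (\<Prod>a\<leftarrow>map Re as. [:- a, 1:])"
    by (simp add: h.hom_prod_list o_def)
  finally have "char_poly A = (\<Prod>a\<leftarrow>map Re as. [:- a, 1:])" by (rule h.injectivity)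
  then show thesis by (rule that)
qed

lemma proots_linear_factors: "proots (\<Prod>e\<leftarrow>es. [:- e, 1:]) = mset (es :: 'a :: idom list)"
proof (induction es)
  case (Cons e es)
  have "(\<Prod>e\<leftarrow>es. [:- e, 1:]) \<noteq> 0" by (auto simp: prod_list_zero_iff)
  then show ?case using Cons by (simp add: proots_mult del: mult_pCons_left)
qed simp

text \<open>Because the polynomial splits over the reals, collecting real roots loses none. The
  length guarantees that \<open>eigval A i\<close> is a genuine list entry for every
  \<open>i\<close> from 1 to \<open>n\<close>.\<close>

lemma symmetric_char_poly_eigvals_desc:
  fixes A :: "real mat"
  assumes A: "A \<in> carrier_mat n n" and sym: "A\<^sup>T = A"
  shows "char_poly A = (\<Prod>e\<leftarrow>eigvals_desc A. [:- e, 1:])" and "length (eigvals_desc A) = n"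
proof -
  obtain es where es: "char_poly A = (\<Prod>e\<leftarrow>es. [:- e, 1:])"
    using symmetric_char_poly_splits[OF A sym] .
  have m: "mset (eigvals_desc A) = mset es"
    unfolding eigvals_desc_def es by (simp add: proots_linear_factors)
  have "(\<Prod>e\<leftarrow>eigvals_desc A. [:- e, 1:]) = prod_mset (image_mset (\<lambda>e. [:- e, 1:]) (mset (eigvals_desc A)))"
    by (simp add: prod_mset_prod_list flip: mset_map)
  also have "\<dots> = (\<Prod>e\<leftarrow>es. [:- e, 1:])"
    unfolding m by (simp add: prod_mset_prod_list flip: mset_map)
  finally show *: "char_poly A = (\<Prod>e\<leftarrow>eigvals_desc A. [:- e, 1:])" unfolding es by simp
  show "length (eigvals_desc A) = n"
    using degree_monic_char_poly[OF A] degree_linear_factors[of uminus "eigvals_desc A", folded *]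
    by simp
qed

section \<open>Orthogonal diagonalization by deflation\<close>

lemma orthonormal_matD:
  assumes "orthonormal_mat n U"
  shows "U \<in> carrier_mat n n" "U\<^sup>T * U = 1\<^sub>m n" "U * U\<^sup>T = 1\<^sub>m n"
  using assms mat_mult_left_right_inverse[of "U\<^sup>T" n U] unfolding orthonormal_mat_def by auto

lemma orthonormal_mat_mult:
  assumes U: "orthonormal_mat n U" and V: "orthonormal_mat n V"
  shows "orthonormal_mat n (U * V)"
proof -
  note u = orthonormal_matD[OF U] and v = orthonormal_matD[OF V]
  have "(U * V)\<^sup>T * (U * V) = V\<^sup>T * ((U\<^sup>T * U) * V)"
    using u(1) v(1) by (simp add: transpose_mult[of _ n n] assoc_mult_mat[of _ n n _ n _ n])
  also have "\<dots> = 1\<^sub>m n" using u v by simp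
  finally show ?thesis using u(1) v(1) unfolding orthonormal_mat_def by simp
qed

text \<open>The Householder reflection exchanging \<open>u\<close> and the first unit vector.\<close>

lemma orthonormal_mat_first_col:
  fixes u :: "real vec"
  assumes u: "u \<in> carrier_vec n" and unit: "u \<bullet> u = 1"
  obtains H where "orthonormal_mat n H" "col H 0 = u"
proof -
  have n: "0 < n" using u unit by (cases n) (auto simp: scalar_prod_def)
  have usum: "(\<Sum>i<n. u $ i * u $ i) = 1"
    using u unit by (simp add: scalar_prod_def atLeast0LessThan)
  \<comment> \<open>The normal of the reflecting hyperplane, \<open>u\<close> minus the first unit
    vector.\<close>
  define w where "w = (\<lambda>i. u $ i - (if i = 0 then 1 else 0))"
  have ww: "(\<Sum>k<n. w k * w k) = 2 * (1 - u $ 0)"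
  proof -
    have "(\<Sum>k<n. w k * w k)
        = (\<Sum>k<n. u $ k * u $ k + (if k = 0 then 1 - 2 * u $ 0 else 0))"
      unfolding w_def by (intro sum.cong refl) (auto simp: algebra_simps)
    also have "\<dots> = 1 + (1 - 2 * u $ 0)"
      using n by (simp add: sum.distrib usum)
    finally show ?thesis by simp
  qed
  show thesis
  \<comment> \<open>Here the normal vanishes and there is no reflection; \<open>u\<close> is already
    the first unit vector, so the identity serves.\<close>
  proof (cases "u $ 0 = 1")
    case True
    have "w i = 0" if "i < n" for i
    proof -
      have "w i * w i \<le> (\<Sum>k<n. w k * w k)" using that by (intro member_le_sum) auto
      then have "w i * w i \<le> 0" unfolding ww True by simp
      then show ?thesis using not_real_square_gt_zero[of "w i"] by simp
    qed
    then have ui: "u $ i = (if i = 0 then 1 else 0)" if "i < n" for i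
      using \<open>\<And>i. i < n \<Longrightarrow> w i = 0\<close>[OF that] unfolding w_def by (auto split: if_splits)
    have "col (1\<^sub>m n) 0 = u"
      by (rule eq_vecI) (use u n ui in auto)
    moreover have "orthonormal_mat n (1\<^sub>m n)" unfolding orthonormal_mat_def by simp
    ultimately show ?thesis using that by blast
  next
    case False
    \<comment> \<open>The Householder factor, 2 divided by the squared length of \<open>w\<close>,
      which \<open>ww\<close> evaluates.\<close>
    define c where "c = 1 / (1 - u $ 0)"
    have c: "c * (2 * (1 - u $ 0)) = 2" "c * (1 - u $ 0) = 1" using False unfolding c_def by (auto simp: field_simps)
    define H where "H = mat n n (\<lambda>(i,j). (if i = j then 1 else 0) - c * w i * w j)"
    have H: "H \<in> carrier_mat n n" "H\<^sup>T = H" unfolding H_def by (auto intro!: eq_matI)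
    have "H * H = 1\<^sub>m n"
    proof (rule eq_matI)
      fix i j assume ij: "i < dim_row (1\<^sub>m n :: real mat)" "j < dim_col (1\<^sub>m n :: real mat)"
      have "(H * H) $$ (i,j) = (\<Sum>k<n. ((if i = k then 1 else 0) - c * w i * w k)
          * ((if k = j then 1 else 0) - c * w k * w j))"
        using ij unfolding H_def by (simp add: scalar_prod_def atLeast0LessThan)
      also have "\<dots> = (\<Sum>k<n. (if k = i then (if i = j then 1 else 0) - c * w i * w j else 0)
          + (if k = j then - c * w i * w j else 0) + c * c * w i * w j * (w k * w k))"
        by (intro sum.cong refl) (auto simp: algebra_simps)
      also have "\<dots> = (if i = j then 1 else 0) - 2 * c * w i * w j
          + c * w i * w j * (c * (2 * (1 - u $ 0)))"
        using ij by (simp add: sum.distrib ww flip: sum_distrib_left)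
      also have "\<dots> = 1\<^sub>m n $$ (i,j)" unfolding c using ij by simp
      finally show "(H * H) $$ (i,j) = 1\<^sub>m n $$ (i,j)" .
    qed (use H in auto)
    then have "orthonormal_mat n H" using H unfolding orthonormal_mat_def by simp
    moreover have "col H 0 = u"
    proof (rule eq_vecI)
      fix i assume i: "i < dim_vec u"
      have "col H 0 $ i = (if i = 0 then 1 else 0) - c * w i * w 0"
        using i u n unfolding H_def by simp
      also have "\<dots> = (if i = 0 then 1 else 0) + (c * (1 - u $ 0)) * w i"
        unfolding w_def by (simp add: algebra_simps)
      also have "\<dots> = u $ i" unfolding c w_def by simp
      finally show "col H 0 $ i = u $ i" .
    qed (use H u in auto)
    ultimately show ?thesis using that by blast
  qed
qed

lemma symmetric_conj:
  fixes A :: "real mat"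
  assumes "A \<in> carrier_mat n n" "A\<^sup>T = A" "W \<in> carrier_mat n m"
  shows "(W\<^sup>T * A * W)\<^sup>T = W\<^sup>T * A * W" "W\<^sup>T * A * W \<in> carrier_mat m m"
proof -
  show "(W\<^sup>T * A * W)\<^sup>T = W\<^sup>T * A * W"
    using assms by (simp add: transpose_mult[of _ m n _ m] transpose_mult[of _ n n _ m] assoc_mult_mat[of _ m n _ n _ m])
  show "W\<^sup>T * A * W \<in> carrier_mat m m" using assms by simp
qed

lemma orthonormal_similar:
  assumes U: "orthonormal_mat n U" and A: "A \<in> carrier_mat n n"
  shows "similar_mat A (U\<^sup>T * A * U)"
proof -
  note u = orthonormal_matD[OF U]
  have "U * (U\<^sup>T * A * U) * U\<^sup>T = (U * U\<^sup>T) * A * (U * U\<^sup>T)"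
    using u(1) A by (simp add: assoc_mult_mat[of _ n n _ n _ n])
  then have "A = U * (U\<^sup>T * A * U) * U\<^sup>T" using u A by simp
  then have "similar_mat_wit A (U\<^sup>T * A * U) U U\<^sup>T"
    unfolding similar_mat_wit_def Let_def using u A by auto
  then show ?thesis unfolding similar_mat_def by blast
qed

text \<open>Induction on the list of roots: an orthogonal change of basis moves a unit eigenvector
  for the first root to the front, symmetry splits off a 1 by 1 block, and the remaining block has
  the remaining linear factors. The diagonal follows the order of the given list, so a sorted list
  yields a sorted diagonal.\<close>

lemma symmetric_diagonalizable:
  fixes A :: "real mat"
  assumes "A \<in> carrier_mat n n" "A\<^sup>T = A" "char_poly A = (\<Prod>e\<leftarrow>es. [:- e, 1:])"
  shows "\<exists>U. orthonormal_mat n U \<and> U\<^sup>T * A * U = mat_diag n (\<lambda>i. es ! i)"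
  using assms
proof (induction es arbitrary: n A)
  case Nil
  then have "n = 0" using degree_monic_char_poly[OF Nil(1)] by simp
  then show ?case using Nil(1)
    by (intro exI[of _ "1\<^sub>m 0"]) (auto simp: orthonormal_mat_def mat_diag_def)
next
  case (Cons e es)
  note A = Cons.prems(1) and sym = Cons.prems(2) and cp = Cons.prems(3)
  have "poly (char_poly A) e = 0" unfolding cp by simp
  then have "eigenvalue A e" using eigenvalue_root_char_poly[OF A] by blast
  then obtain v where v: "v \<in> carrier_vec n" "v \<noteq> 0\<^sub>v n" "A *\<^sub>v v = e \<cdot>\<^sub>v v"
    using A unfolding eigenvalue_def eigenvector_def by auto
  have "v \<bullet> v > 0" using v(1,2) conjugate_square_greater_0_vec[of v n] by simp
  define u where "u = (1 / sqrt (v \<bullet> v)) \<cdot>\<^sub>v v"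
  have u: "u \<in> carrier_vec n" "u \<bullet> u = 1" "A *\<^sub>v u = e \<cdot>\<^sub>v u"
    using v \<open>v \<bullet> v > 0\<close> A unfolding u_def
    by (auto simp: mult_mat_vec smult_smult_assoc mult.commute)
  obtain H where H: "orthonormal_mat n H" and colH: "col H 0 = u"
    using orthonormal_mat_first_col[OF u(1,2)] by blast
  note h = orthonormal_matD[OF H]
  obtain m where n: "n = Suc m"
    using v(1,2) by (cases n) auto
  define B where "B = H\<^sup>T * A * H"
  have B: "B \<in> carrier_mat n n" "B\<^sup>T = B"
    unfolding B_def using symmetric_conj[OF A sym h(1)] by auto
  have symB: "B $$ (j,i) = B $$ (i,j)" if "i < n" "j < n" for i j
    using that B by (metis carrier_matD index_transpose_mat(1))
  have colB: "col B 0 = e \<cdot>\<^sub>v unit_vec n 0"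
  proof -
    have "col B 0 = (H\<^sup>T * A) *\<^sub>v col H 0" unfolding B_def
      using A h(1) n by (intro col_mult2[of _ n n _ n]) auto
    also have "\<dots> = H\<^sup>T *\<^sub>v (A *\<^sub>v u)" unfolding colH using A h(1) u(1) by simp
    also have "\<dots> = e \<cdot>\<^sub>v (H\<^sup>T *\<^sub>v col H 0)" unfolding u(3) colH using h(1) u(1)
      by (simp add: mult_mat_vec[of _ n n])
    also have "H\<^sup>T *\<^sub>v col H 0 = col (H\<^sup>T * H) 0"
      using h(1) n by (intro col_mult2[symmetric, of _ n n _ n]) auto
    also have "\<dots> = unit_vec n 0" unfolding h(2) using n by simp
    finally show ?thesis .
  qed
  have B0: "B $$ (i,0) = (if i = 0 then e else 0)" if "i < n" for i
    using arg_cong[OF colB, of "\<lambda>w. w $ i"] that B n by auto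
  define E where "E = mat 1 1 (\<lambda>_. e)"
  define A2 where "A2 = mat m m (\<lambda>(i,j). B $$ (Suc i, Suc j))"
  have A2: "A2 \<in> carrier_mat m m" "A2\<^sup>T = A2"
    unfolding A2_def by (auto intro!: eq_matI simp: symB n)
  have E: "E \<in> carrier_mat 1 1" unfolding E_def by simp
  \<comment> \<open>The eigenvector clears the first column below the corner; symmetry of
    \<open>B\<close> clears the first row.\<close>
  have Bblock: "B = four_block_mat E (0\<^sub>m 1 m) (0\<^sub>m m 1) A2"
  proof (rule eq_matI)
    fix i j assume ij: "i < dim_row (four_block_mat E (0\<^sub>m 1 m) (0\<^sub>m m 1) A2)"
      "j < dim_col (four_block_mat E (0\<^sub>m 1 m) (0\<^sub>m m 1) A2)"
    then have ij: "i < n" "j < n" using E A2 n by auto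
    show "B $$ (i,j) = four_block_mat E (0\<^sub>m 1 m) (0\<^sub>m m 1) A2 $$ (i,j)"
      using B0[OF ij(1)] B0[OF ij(2)] symB[OF ij(2) , of 0] ij n E A2
      by (cases i; cases j) (auto simp: E_def A2_def)
  qed (use B E A2 n in auto)
  have "[:- e, 1:] * (\<Prod>e\<leftarrow>es. [:- e, 1:]) = char_poly B"
    using char_poly_similar[OF orthonormal_similar[OF H A]] cp unfolding B_def by simp
  also have "\<dots> = char_poly E * char_poly A2"
    unfolding Bblock by (rule char_poly_four_block_zeros_col[OF E _ A2(1)]) simp
  also have "char_poly E = [:- e, 1:]"
    unfolding E_def by (subst char_poly_upper_triangular[of _ 1]) (auto simp: diag_mat_def)
  finally have "char_poly A2 = (\<Prod>e\<leftarrow>es. [:- e, 1:])"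
    by (metis mult_left_cancel pCons_eq_0_iff zero_neq_one)
  from Cons.IH[OF A2 this] obtain V where V: "orthonormal_mat m V"
    and VA: "V\<^sup>T * A2 * V = mat_diag m (\<lambda>i. es ! i)" by blast
  note v' = orthonormal_matD[OF V]
  \<comment> \<open>The rotation of the smaller block, extended so as to fix the eigenvector already
    split off.\<close>
  define F where "F = four_block_mat (1\<^sub>m 1) (0\<^sub>m 1 m) (0\<^sub>m m 1) V"
  have F: "F \<in> carrier_mat n n" using v' n unfolding F_def by auto
  have FT: "F\<^sup>T = four_block_mat (1\<^sub>m 1) (0\<^sub>m 1 m) (0\<^sub>m m 1) V\<^sup>T"
    unfolding F_def using v'
    by (subst transpose_four_block_mat[of _ 1 1 _ m _ m]) auto
  have "F\<^sup>T * F = four_block_mat (1\<^sub>m 1) (0\<^sub>m 1 m) (0\<^sub>m m 1) (1\<^sub>m m)"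
    unfolding FT unfolding F_def using v'
    by (subst mult_four_block_mat[of _ 1 1 _ m _ m _ _ 1 _ m]) auto
  then have orthF: "orthonormal_mat n F"
    using F n unfolding orthonormal_mat_def by simp
  have "F\<^sup>T * B * F = four_block_mat E (0\<^sub>m 1 m) (0\<^sub>m m 1) (V\<^sup>T * A2 * V)"
  proof -
    have "F\<^sup>T * B = four_block_mat E (0\<^sub>m 1 m) (0\<^sub>m m 1) (V\<^sup>T * A2)"
      unfolding FT Bblock using v' E A2
      by (subst mult_four_block_mat[of _ 1 1 _ m _ m _ _ 1 _ m]) auto
    then show ?thesis
      unfolding F_def using v' E A2
      by (simp add: mult_four_block_mat[of _ 1 1 _ m _ m _ _ 1 _ m])
  qed
  also have "\<dots> = mat_diag n (\<lambda>i. (e # es) ! i)"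
    unfolding VA by (rule eq_matI) (auto simp: mat_diag_def E_def n nth_Cons')
  finally have FBF: "F\<^sup>T * B * F = mat_diag n (\<lambda>i. (e # es) ! i)" .
  have "(H * F)\<^sup>T * A * (H * F) = F\<^sup>T * B * F"
    unfolding B_def using h(1) F A
    by (simp add: transpose_mult[of _ n n] assoc_mult_mat[of _ n n _ n _ n])
  then show ?case using FBF orthonormal_mat_mult[OF H orthF] by auto
qed

text \<open>The order of the columns is fixed by the decreasing order of \<open>eigval\<close>. The
  shift reconciles columns counted from 0 with eigenvalues counted from 1.\<close>

definition spectral_basis :: "nat \<Rightarrow> real mat \<Rightarrow> real mat \<Rightarrow> bool" where
  "spectral_basis n A U \<longleftrightarrow>
     orthonormal_mat n U \<and> A = U * mat_diag n (\<lambda>i. eigval A (i + 1)) * U\<^sup>T"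

lemma spectral_basis_exists:
  fixes A :: "real mat"
  assumes A: "A \<in> carrier_mat n n" and sym: "A\<^sup>T = A"
  obtains U where "spectral_basis n A U"
proof -
  obtain U where U: "orthonormal_mat n U" "U\<^sup>T * A * U = mat_diag n (\<lambda>i. eigvals_desc A ! i)"
    using symmetric_diagonalizable[OF A sym symmetric_char_poly_eigvals_desc(1)[OF A sym]] by blast
  note u = orthonormal_matD[OF U(1)]
  have "U * (U\<^sup>T * A * U) * U\<^sup>T = (U * U\<^sup>T) * A * (U * U\<^sup>T)"
    using u(1) A by (simp add: assoc_mult_mat[of _ n n _ n _ n])
  then have "A = U * mat_diag n (\<lambda>i. eigvals_desc A ! i) * U\<^sup>T" using u A U(2) by simp
  then have "spectral_basis n A U" using U(1) unfolding spectral_basis_def eigval_def by simp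
  then show thesis by (rule that)
qed

lemma eigval_antimono:
  assumes A: "A \<in> carrier_mat n n" and sym: "A\<^sup>T = A"
    and "1 \<le> i" "i \<le> j" "j \<le> n"
  shows "eigval A j \<le> eigval A i"
proof -
  have "sorted (rev (eigvals_desc A))" unfolding eigvals_desc_def by simp
  then show ?thesis
    using assms symmetric_char_poly_eigvals_desc(2)[OF A sym] unfolding eigval_def
    by (auto simp: sorted_rev_iff_nth_mono)
qed

text \<open>Similarity fixes the multiset of roots, and a multiset has only one sorted listing. This
  reads off the eigenvalues of \<open>X\<^sup>T * X\<close> from those of \<open>X\<close>.\<close>

lemma eigval_unique:
  fixes d :: "nat \<Rightarrow> real"
  assumes U: "orthonormal_mat n U" and A: "A = U * mat_diag n d * U\<^sup>T"
    and d: "\<And>i j. i \<le> j \<Longrightarrow> j < n \<Longrightarrow> d j \<le> d i"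
    and k: "1 \<le> k" "k \<le> n"
  shows "eigval A k = d (k - 1)"
proof -
  note u = orthonormal_matD[OF U]
  have "similar_mat_wit A (mat_diag n d) U U\<^sup>T"
    unfolding similar_mat_wit_def Let_def using u A by auto
  then have "char_poly A = char_poly (mat_diag n d)"
    using char_poly_similar unfolding similar_mat_def by blast
  also have "\<dots> = (\<Prod>e\<leftarrow>map d [0..<n]. [:- e, 1:])"
    by (subst char_poly_upper_triangular[of _ n])
      (auto simp: mat_diag_def diag_mat_def intro!: arg_cong[of _ _ prod_list])
  finally have cp: "char_poly A = (\<Prod>e\<leftarrow>map d [0..<n]. [:- e, 1:])" .
  have "mset (rev (eigvals_desc A)) = mset (rev (map d [0..<n]))"
    unfolding eigvals_desc_def cp proots_linear_factors by simp
  moreover have "sorted (rev (eigvals_desc A))" unfolding eigvals_desc_def by simp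
  moreover have "sorted (rev (map d [0..<n]))"
    by (auto simp: sorted_rev_iff_nth_mono d)
  ultimately have "rev (eigvals_desc A) = rev (map d [0..<n])"
    by (metis properties_for_sort)
  then show ?thesis using k unfolding eigval_def by simp
qed

section \<open>Eigenvalue inequalities\<close>

lemma orthonormal_cols_isometry:
  fixes J :: "real mat"
  assumes "J \<in> carrier_mat n m" "J\<^sup>T * J = 1\<^sub>m m" "w \<in> carrier_vec m"
  shows "(J *\<^sub>v w) \<bullet> (J *\<^sub>v w) = w \<bullet> w"
proof -
  have "(J *\<^sub>v w) \<bullet> (J *\<^sub>v w) = (J\<^sup>T *\<^sub>v (J *\<^sub>v w)) \<bullet> w"
    by (rule transpose_vec_mult_scalar[symmetric]) (use assms in auto)
  also have "J\<^sup>T *\<^sub>v (J *\<^sub>v w) = (J\<^sup>T * J) *\<^sub>v w"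
    by (rule assoc_mult_mat_vec[symmetric]) (use assms in auto)
  finally show ?thesis using assms by simp
qed

lemma mat_diag_mult_vec:
  fixes y :: "real vec"
  assumes "y \<in> carrier_vec n"
  shows "mat_diag n d *\<^sub>v y = vec n (\<lambda>i. d i * y $ i)"
proof (rule eq_vecI)
  fix i assume i: "i < dim_vec (vec n (\<lambda>i. d i * y $ i))"
  have "(mat_diag n d *\<^sub>v y) $ i = (\<Sum>k\<in>{0..<n}. (if i = k then d k else 0) * y $ k)"
    using i assms by (simp add: mat_diag_def scalar_prod_def)
  also have "\<dots> = (\<Sum>k\<in>{0..<n}. if i = k then d k * y $ k else 0)"
    by (intro sum.cong) auto
  finally show "(mat_diag n d *\<^sub>v y) $ i = vec n (\<lambda>i. d i * y $ i) $ i" using i by simp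
qed (simp add: mat_diag_def)

text \<open>In the coordinates \<open>U\<^sup>T *\<^sub>v w\<close> both forms become weighted sums
  of the same squares, so Rayleigh quotients can be compared term by term.\<close>

lemma quadratic_form_diag:
  fixes d :: "nat \<Rightarrow> real"
  assumes U: "orthonormal_mat n U" and w: "w \<in> carrier_vec n"
  shows "w \<bullet> ((U * mat_diag n d * U\<^sup>T) *\<^sub>v w) = (\<Sum>i<n. d i * ((U\<^sup>T *\<^sub>v w) $ i)\<^sup>2)"
    and "w \<bullet> w = (\<Sum>i<n. ((U\<^sup>T *\<^sub>v w) $ i)\<^sup>2)"
proof -
  note u = orthonormal_matD[OF U]
  let ?y = "U\<^sup>T *\<^sub>v w"
  have y: "?y \<in> carrier_vec n" using u(1) w by simp
  have "(U * mat_diag n d * U\<^sup>T) *\<^sub>v w = U *\<^sub>v (mat_diag n d *\<^sub>v ?y)"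
    using u(1) w by (simp add: mult_carrier_mat[of _ n n _ n] mult_mat_vec_carrier[of _ n n]
        assoc_mult_mat[of _ n n _ n _ n] assoc_mult_mat_vec[of _ n n _ n])
  then have "w \<bullet> ((U * mat_diag n d * U\<^sup>T) *\<^sub>v w) = ?y \<bullet> (mat_diag n d *\<^sub>v ?y)"
    using transpose_vec_mult_scalar[OF u(1) _ w, of "mat_diag n d *\<^sub>v ?y"]
      mult_mat_vec_carrier[OF mat_diag_dim y] by simp
  also have "\<dots> = (\<Sum>i<n. d i * (?y $ i)\<^sup>2)"
    unfolding mat_diag_mult_vec[OF y]
    by (simp add: scalar_prod_def atLeast0LessThan power2_eq_square mult_ac)
  finally show "w \<bullet> ((U * mat_diag n d * U\<^sup>T) *\<^sub>v w) = (\<Sum>i<n. d i * (?y $ i)\<^sup>2)" .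
  have "w \<bullet> w = ?y \<bullet> ?y"
    using orthonormal_cols_isometry[of "U\<^sup>T" n n w] u w by simp
  also have "\<dots> = (\<Sum>i<n. (?y $ i)\<^sup>2)"
    using u(1) w by (simp add: scalar_prod_def atLeast0LessThan power2_eq_square)
  finally show "w \<bullet> w = (\<Sum>i<n. (?y $ i)\<^sup>2)" .
qed

text \<open>The dimension count behind the min-max principle: \<open>k - 1\<close> homogeneous
  equations in \<open>k\<close> unknowns have a nontrivial solution. The zero last row pads the
  system to a square one, so that a vanishing determinant gives it.\<close>

lemma wide_kernel_vec:
  fixes B :: "real mat"
  assumes B: "B \<in> carrier_mat k k" and k: "0 < k" and zero: "\<And>j. j < k \<Longrightarrow> B $$ (k - 1, j) = 0"
  obtains c where "c \<in> carrier_vec k" "c \<noteq> 0\<^sub>v k" "B *\<^sub>v c = 0\<^sub>v k"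
proof -
  have "B\<^sup>T *\<^sub>v unit_vec k (k - 1) = 0\<^sub>v k"
    by (rule eq_vecI) (use B k zero in auto)
  moreover have "unit_vec k (k - 1) \<noteq> (0\<^sub>v k :: real vec)" using k by simp
  ultimately have "det B\<^sup>T = 0"
    using det_0_iff_vec_prod_zero[of "B\<^sup>T" k] B by (meson transpose_carrier_mat unit_vec_carrier)
  then show thesis using det_0_iff_vec_prod_zero[OF B] det_transpose[OF B] that by auto
qed

text \<open>Taking \<open>J\<close> to be a coordinate embedding gives the upper half of Cauchy's interlacing
  inequalities; taking it to be the identity gives Weyl's monotonicity.\<close>

lemma eigval_compression_le:
  fixes X Y J :: "real mat"
  assumes X: "X \<in> carrier_mat n n" "X\<^sup>T = X" and Y: "Y \<in> carrier_mat m m" "Y\<^sup>T = Y"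
    and J: "J \<in> carrier_mat n m" "J\<^sup>T * J = 1\<^sub>m m"
    and le: "\<And>w. w \<in> carrier_vec m \<Longrightarrow> w \<bullet> (Y *\<^sub>v w) \<le> (J *\<^sub>v w) \<bullet> (X *\<^sub>v (J *\<^sub>v w))"
    and k: "1 \<le> k" "k \<le> m" "m \<le> n"
  shows "eigval Y k \<le> eigval X k"
proof -
  obtain U where "spectral_basis n X U" using spectral_basis_exists[OF X] .
  then have U: "orthonormal_mat n U" and XU: "X = U * mat_diag n (\<lambda>i. eigval X (i + 1)) * U\<^sup>T"
    unfolding spectral_basis_def by auto
  obtain V where "spectral_basis m Y V" using spectral_basis_exists[OF Y] .
  then have V: "orthonormal_mat m V" and YV: "Y = V * mat_diag m (\<lambda>i. eigval Y (i + 1)) * V\<^sup>T"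
    unfolding spectral_basis_def by auto
  note u = orthonormal_matD[OF U] and v = orthonormal_matD[OF V]
  define G where "G = U\<^sup>T * J * V"
  have G: "G \<in> carrier_mat n m" using u(1) v(1) J(1) unfolding G_def by simp
  \<comment> \<open>Row \<open>i\<close> of \<open>G\<close> gives the coordinate of
    \<open>J *\<^sub>v (V *\<^sub>v c')\<close> along the eigenvector of \<open>X\<close> with index
    \<open>i\<close>. A kernel vector of \<open>B\<close> thus combines the top \<open>k\<close>
    eigenvectors of \<open>Y\<close> into a \<open>w\<close> whose image is orthogonal to the top
    \<open>k - 1\<close> eigenvectors of \<open>X\<close>.\<close>
  define B where "B = mat k k (\<lambda>(i,j). if i < k - 1 then G $$ (i,j) else 0)"
  obtain c where c: "c \<in> carrier_vec k" "c \<noteq> 0\<^sub>v k" "B *\<^sub>v c = 0\<^sub>v k"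
    by (rule wide_kernel_vec[of B k]) (use k in \<open>auto simp: B_def\<close>)
  define c' where "c' = vec m (\<lambda>j. if j < k then c $ j else 0)"
  define w where "w = V *\<^sub>v c'"
  define z where "z = J *\<^sub>v w"
  have c': "c' \<in> carrier_vec m" unfolding c'_def by simp
  have w: "w \<in> carrier_vec m" unfolding w_def using v(1) c' by simp
  have z: "z \<in> carrier_vec n" unfolding z_def using J(1) w by simp
  have Vw: "V\<^sup>T *\<^sub>v w = c'"
    unfolding w_def using v c' by (simp flip: assoc_mult_mat_vec[of _ m m _ m])
  have Uz: "U\<^sup>T *\<^sub>v z = G *\<^sub>v c'"
    unfolding z_def w_def G_def using u(1) v(1) J(1) c'
    by (simp add: assoc_mult_mat_vec[of _ n m _ m] assoc_mult_mat_vec[of _ n n _ m])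
  have Uz0: "(U\<^sup>T *\<^sub>v z) $ i = 0" if "i < k - 1" for i
  proof -
    have i: "i < k" "i < n" using that k by auto
    have "(U\<^sup>T *\<^sub>v z) $ i = (\<Sum>j<m. G $$ (i,j) * (if j < k then c $ j else 0))"
      unfolding Uz using G i by (simp add: scalar_prod_def atLeast0LessThan c'_def)
    also have "\<dots> = (\<Sum>j<k. G $$ (i,j) * c $ j)"
      by (rule sum.mono_neutral_cong_right) (use k in auto)
    also have "\<dots> = (B *\<^sub>v c) $ i"
      using c(1) i that unfolding B_def by (simp add: scalar_prod_def atLeast0LessThan)
    finally show ?thesis unfolding c(3) using i by simp
  qed
  have pos: "w \<bullet> w > 0"
  proof -
    obtain j where "j < k" "c $ j \<noteq> 0" using c(1,2) by force
    then have "c' $ j \<noteq> 0" "j < m" unfolding c'_def using k by auto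
    then have "0 < (\<Sum>i<m. (c' $ i)\<^sup>2)" by (intro sum_pos2[of _ j]) auto
    then show ?thesis unfolding quadratic_form_diag(2)[OF V w] Vw .
  qed
  \<comment> \<open>Only coordinates with eigenvalue at least \<open>eigval Y k\<close> occur in
    \<open>w\<close>.\<close>
  have "eigval Y k * (w \<bullet> w) \<le> w \<bullet> (Y *\<^sub>v w)"
    unfolding quadratic_form_diag(2)[OF V w] sum_distrib_left
    by (subst (2) YV, subst quadratic_form_diag(1)[OF V w], rule sum_mono)
      (unfold Vw, use eigval_antimono[OF Y _ _ \<open>k \<le> m\<close>] in
        \<open>force simp: c'_def not_less intro: mult_right_mono\<close>)
  also have "\<dots> \<le> z \<bullet> (X *\<^sub>v z)" unfolding z_def by (rule le[OF w])
  \<comment> \<open>By \<open>Uz0\<close>, only coordinates with eigenvalue at most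
    \<open>eigval X k\<close> contribute to \<open>z\<close>.\<close>
  also have "\<dots> \<le> eigval X k * (z \<bullet> z)"
    unfolding quadratic_form_diag(2)[OF U z] sum_distrib_left
  proof (subst XU, subst quadratic_form_diag(1)[OF U z], rule sum_mono)
    fix i assume i: "i \<in> {..<n}"
    show "eigval X (i + 1) * ((U\<^sup>T *\<^sub>v z) $ i)\<^sup>2 \<le> eigval X k * ((U\<^sup>T *\<^sub>v z) $ i)\<^sup>2"
    proof (cases "i < k - 1")
      case True
      then show ?thesis using Uz0 by simp
    next
      case False
      then show ?thesis
        using i k eigval_antimono[OF X, of k "i + 1"] by (intro mult_right_mono) auto
    qed
  qed
  also have "z \<bullet> z = w \<bullet> w" unfolding z_def by (rule orthonormal_cols_isometry[OF J w])
  finally show ?thesis using pos by simp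
qed

section \<open>Positivity, determinant, trace of the inverse and singular values from the
  spectrum\<close>

text \<open>Column \<open>k - 1\<close> of a spectral basis is the witness. It turns definiteness of
  the form into the sign of every eigenvalue.\<close>

lemma eigval_eq_quadratic_form:
  fixes A :: "real mat"
  assumes A: "A \<in> carrier_mat n n" "A\<^sup>T = A" and k: "1 \<le> k" "k \<le> n"
  obtains u where "u \<in> carrier_vec n" "u \<bullet> u = 1" "u \<bullet> (A *\<^sub>v u) = eigval A k"
proof -
  obtain U where "spectral_basis n A U" using spectral_basis_exists[OF A] .
  then have U: "orthonormal_mat n U" and AU: "A = U * mat_diag n (\<lambda>i. eigval A (i + 1)) * U\<^sup>T"
    unfolding spectral_basis_def by auto
  note u = orthonormal_matD[OF U]
  define v where "v = U *\<^sub>v unit_vec n (k - 1)"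
  have v: "v \<in> carrier_vec n" unfolding v_def using u(1) by simp
  have Uv: "U\<^sup>T *\<^sub>v v = unit_vec n (k - 1)"
    unfolding v_def using u by (simp flip: assoc_mult_mat_vec[of _ n n _ n])
  have *: "(\<Sum>i<n. f i * (unit_vec n (k - 1) $ i)\<^sup>2) = f (k - 1)" for f :: "nat \<Rightarrow> real"
  proof -
    have "(\<Sum>i<n. f i * (unit_vec n (k - 1) $ i)\<^sup>2) = (\<Sum>i<n. if i = k - 1 then f i else 0)"
      using k by (intro sum.cong) (auto simp: unit_vec_def)
    then show ?thesis using k by simp
  qed
  have "v \<bullet> v = 1"
    unfolding quadratic_form_diag(2)[OF U v] Uv using *[of "\<lambda>_. 1"] by simp
  moreover have "v \<bullet> (A *\<^sub>v v) = eigval A k"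
    by (subst AU, subst quadratic_form_diag(1)[OF U v]) (use Uv * k in simp)
  ultimately show thesis using v that by blast
qed

lemma eigval_nonneg:
  fixes A :: "real mat"
  assumes A: "A \<in> carrier_mat n n" "A\<^sup>T = A" and k: "1 \<le> k" "k \<le> n"
    and psd: "\<And>v. v \<in> carrier_vec n \<Longrightarrow> 0 \<le> v \<bullet> (A *\<^sub>v v)"
  shows "0 \<le> eigval A k"
  using eigval_eq_quadratic_form[OF A k] psd by metis

lemma eigval_pos:
  fixes A :: "real mat"
  assumes A: "A \<in> carrier_mat n n" "A\<^sup>T = A" and k: "1 \<le> k" "k \<le> n" and pd: "pos_def_mat A"
  shows "0 < eigval A k"
proof -
  obtain u where u: "u \<in> carrier_vec n" "u \<bullet> u = 1" "u \<bullet> (A *\<^sub>v u) = eigval A k"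
    using eigval_eq_quadratic_form[OF A k] .
  have "u \<noteq> 0\<^sub>v n" using u(2) by auto
  then show ?thesis using pd u A unfolding pos_def_mat_def by auto
qed

lemma det_eq_prod_eigval:
  fixes A :: "real mat"
  assumes A: "A \<in> carrier_mat n n" "A\<^sup>T = A"
  shows "det A = (\<Prod>i=1..n. eigval A i)"
proof -
  obtain U where "spectral_basis n A U" using spectral_basis_exists[OF A] .
  then have U: "orthonormal_mat n U" and AU: "A = U * mat_diag n (\<lambda>i. eigval A (i + 1)) * U\<^sup>T"
    unfolding spectral_basis_def by auto
  note u = orthonormal_matD[OF U]
  let ?D = "mat_diag n (\<lambda>i. eigval A (i + 1))"
  have "det A = det U * det ?D * det U\<^sup>T"
    by (subst AU) (use u(1) in \<open>simp add: det_mult[of _ n]\<close>)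
  also have "\<dots> = det (U\<^sup>T * U) * det ?D"
    using u(1) by (simp add: det_mult[of _ n])
  also have "\<dots> = det ?D" unfolding u(2) by simp
  also have "\<dots> = (\<Prod>i<n. eigval A (i + 1))"
    by (subst det_upper_triangular[of _ n])
      (auto simp: mat_diag_def diag_mat_def prod.distinct_set_conv_list atLeast0LessThan[symmetric]
        simp flip: prod.distinct_set_conv_list intro!: arg_cong[of _ _ prod_list])
  also have "\<dots> = (\<Prod>i=1..n. eigval A i)"
    by (simp add: prod.atLeast1_atMost_eq)
  finally show ?thesis .
qed

text \<open>Inverting the spectral diagonal gives a right inverse of \<open>A\<close>, which must
  equal \<open>B\<close>; since the columns of \<open>U\<close> have unit length, its diagonal sums
  to the reciprocals of the eigenvalues.\<close>

lemma sum_diag_inverse: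
  fixes A B :: "real mat"
  assumes A: "A \<in> carrier_mat n n" "A\<^sup>T = A" and B: "B \<in> carrier_mat n n" "B * A = 1\<^sub>m n"
    and nz: "\<And>i. 1 \<le> i \<Longrightarrow> i \<le> n \<Longrightarrow> eigval A i \<noteq> 0"
  shows "(\<Sum>i<n. B $$ (i,i)) = (\<Sum>i=1..n. inverse (eigval A i))"
proof -
  obtain U where "spectral_basis n A U" using spectral_basis_exists[OF A] .
  then have U: "orthonormal_mat n U" and AU: "A = U * mat_diag n (\<lambda>i. eigval A (i + 1)) * U\<^sup>T"
    unfolding spectral_basis_def by auto
  note u = orthonormal_matD[OF U]
  let ?D = "mat_diag n (\<lambda>i. eigval A (i + 1))" and ?E = "mat_diag n (\<lambda>i. inverse (eigval A (i + 1)))"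
  let ?C = "U * ?E * U\<^sup>T"
  have C: "?C \<in> carrier_mat n n" using u(1) by (simp add: mult_carrier_mat[of _ n n _ n])
  have DE: "?D * ?E = 1\<^sub>m n"
    unfolding mat_diag_diag by (rule eq_matI) (auto simp: mat_diag_def nz)
  have "A * ?C = U * (?D * ((U\<^sup>T * U) * (?E * U\<^sup>T)))"
    by (subst AU) (use u(1) in \<open>simp add: mult_carrier_mat[of _ n n _ n] assoc_mult_mat[of _ n n _ n _ n]\<close>)
  also have "\<dots> = U * ((?D * ?E) * U\<^sup>T)"
    unfolding u(2) using u(1) by (simp add: mult_carrier_mat[of _ n n _ n] left_mult_one_mat[of _ n n]
      assoc_mult_mat[of _ n n _ n _ n] del: mat_diag_diag)
  also have "\<dots> = 1\<^sub>m n" unfolding DE using u by simp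
  finally have AC: "A * ?C = 1\<^sub>m n" .
  have "B = B * (A * ?C)" unfolding AC using B by simp
  also have "\<dots> = (B * A) * ?C" by (rule assoc_mult_mat[symmetric]) (use A B C in auto)
  finally have BC: "B = ?C" unfolding B(2) left_mult_one_mat[OF C] .
  have entry: "?C $$ (i,i) = (\<Sum>k<n. inverse (eigval A (k + 1)) * (U $$ (i,k) * U $$ (i,k)))"
    if "i < n" for i
    using that u(1)
    by (simp add: mat_diag_mult_right[OF u(1)] scalar_prod_def atLeast0LessThan mult_ac)
  have colU: "(\<Sum>i<n. U $$ (i,k) * U $$ (i,k)) = 1" if "k < n" for k
    using arg_cong[OF u(2), of "\<lambda>M. M $$ (k,k)"] that u(1)
    by (simp add: scalar_prod_def atLeast0LessThan)
  have "(\<Sum>i<n. B $$ (i,i)) = (\<Sum>i<n. \<Sum>k<n. inverse (eigval A (k + 1)) * (U $$ (i,k) * U $$ (i,k)))"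
    unfolding BC by (intro sum.cong refl entry) simp
  also have "\<dots> = (\<Sum>k<n. inverse (eigval A (k + 1)) * (\<Sum>i<n. U $$ (i,k) * U $$ (i,k)))"
    unfolding sum_distrib_left by (rule sum.swap)
  also have "\<dots> = (\<Sum>k<n. inverse (eigval A (k + 1)))" by (simp add: colU)
  also have "\<dots> = (\<Sum>i=1..n. inverse (eigval A i))"
    by (simp add: sum.atLeast1_atMost_eq)
  finally show ?thesis .
qed

text \<open>In the basis of \<open>X\<close> the Gram matrix has the squared eigenvalues on its
  diagonal. Nonnegativity is used twice: it keeps the squares in decreasing order, and it lets the
  square root undo the squaring.\<close>

lemma singval_eq_eigval:
  fixes X :: "real mat"
  assumes X: "X \<in> carrier_mat n n" "X\<^sup>T = X" and k: "1 \<le> k" "k \<le> n"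
    and psd: "\<And>v. v \<in> carrier_vec n \<Longrightarrow> 0 \<le> v \<bullet> (X *\<^sub>v v)"
  shows "singval X k = eigval X k"
proof -
  obtain U where "spectral_basis n X U" using spectral_basis_exists[OF X] .
  then have U: "orthonormal_mat n U" and XU: "X = U * mat_diag n (\<lambda>i. eigval X (i + 1)) * U\<^sup>T"
    unfolding spectral_basis_def by auto
  note u = orthonormal_matD[OF U]
  let ?D = "mat_diag n (\<lambda>i. eigval X (i + 1))"
  have "X\<^sup>T * X = U * (?D * ((U\<^sup>T * U) * (?D * U\<^sup>T)))"
    unfolding X(2)
    by (subst (1 2) XU) (use u(1) in \<open>simp add: mult_carrier_mat[of _ n n _ n] assoc_mult_mat[of _ n n _ n _ n]\<close>)
  also have "\<dots> = U * (?D * ?D) * U\<^sup>T"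
    unfolding u(2) using u(1)
    by (simp add: mult_carrier_mat[of _ n n _ n] left_mult_one_mat[of _ n n]
      assoc_mult_mat[of _ n n _ n _ n] del: mat_diag_diag)
  also have "?D * ?D = mat_diag n (\<lambda>i. eigval X (i + 1) * eigval X (i + 1))" by simp
  finally have "X\<^sup>T * X = U * mat_diag n (\<lambda>i. eigval X (i + 1) * eigval X (i + 1)) * U\<^sup>T" .
  then have "eigval (X\<^sup>T * X) k = eigval X (k - 1 + 1) * eigval X (k - 1 + 1)"
    using k eigval_antimono[OF X] eigval_nonneg[OF X _ _ psd]
    by (intro eigval_unique[OF U]) (auto intro!: mult_mono)
  then show ?thesis
    unfolding singval_def using k eigval_nonneg[OF X k psd] by (simp add: real_sqrt_mult_self)
qed

lemma vol_eq_det: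
  fixes A :: "real mat"
  assumes A: "A \<in> carrier_mat n n" "A\<^sup>T = A"
    and psd: "\<And>v. v \<in> carrier_vec n \<Longrightarrow> 0 \<le> v \<bullet> (A *\<^sub>v v)"
  shows "vol n A = det A"
  unfolding vol_def det_eq_prod_eigval[OF A] by (simp add: singval_eq_eigval[OF A _ _ psd])

text \<open>An entry is a sum of \<open>d k\<close> times products from a row of \<open>U\<close>
  and a row of \<open>V\<close>; the arithmetic-geometric mean inequality and the unit length of
  both rows bound it. Allowing \<open>U\<close> and \<open>V\<close> to differ is what an arbitrary
  singular value decomposition requires.\<close>

lemma orthonormal_diag_entry_le:
  assumes U: "orthonormal_mat n U" and V: "orthonormal_mat n V"
    and d: "\<And>k. k < n \<Longrightarrow> \<bar>d k\<bar> \<le> c" and ij: "i < n" "j < n"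
  shows "\<bar>(U * mat_diag n d * V\<^sup>T) $$ (i,j)\<bar> \<le> c"
proof -
  have row: "(\<Sum>k<n. (W $$ (i,k))\<^sup>2) = 1" if "orthonormal_mat n W" "i < n" for W i
    using arg_cong[OF orthonormal_matD(3)[OF that(1)], of "\<lambda>M. M $$ (i,i)"] that(2)
      orthonormal_matD(1)[OF that(1)]
    by (simp add: scalar_prod_def atLeast0LessThan power2_eq_square)
  have u: "U \<in> carrier_mat n n" and v: "V \<in> carrier_mat n n" using U V orthonormal_matD by auto
  have "0 \<le> c" using d[OF ij(1)] by linarith
  have "\<bar>(U * mat_diag n d * V\<^sup>T) $$ (i,j)\<bar> = \<bar>\<Sum>k<n. d k * (U $$ (i,k) * V $$ (j,k))\<bar>"
    using ij u v
    by (simp add: mat_diag_mult_right[OF u] scalar_prod_def atLeast0LessThan mult_ac)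
  also have "\<dots> \<le> (\<Sum>k<n. \<bar>d k * (U $$ (i,k) * V $$ (j,k))\<bar>)" by (rule sum_abs)
  also have "\<dots> \<le> (\<Sum>k<n. c * (((U $$ (i,k))\<^sup>2 + (V $$ (j,k))\<^sup>2) / 2))"
  proof (rule sum_mono)
    fix k assume k: "k \<in> {..<n}"
    have "\<bar>U $$ (i,k)\<bar> * \<bar>V $$ (j,k)\<bar> \<le> ((U $$ (i,k))\<^sup>2 + (V $$ (j,k))\<^sup>2) / 2"
      using sum_squares_bound[of "\<bar>U $$ (i,k)\<bar>" "\<bar>V $$ (j,k)\<bar>"] by simp
    then show "\<bar>d k * (U $$ (i,k) * V $$ (j,k))\<bar> \<le> c * (((U $$ (i,k))\<^sup>2 + (V $$ (j,k))\<^sup>2) / 2)"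
      unfolding abs_mult using d k \<open>0 \<le> c\<close> by (intro mult_mono) auto
  qed
  also have "\<dots> = c * (((\<Sum>k<n. (U $$ (i,k))\<^sup>2) + (\<Sum>k<n. (V $$ (j,k))\<^sup>2)) / 2)"
    by (simp add: sum.distrib flip: sum_distrib_left sum_divide_distrib)
  also have "\<dots> = c" using row[OF U ij(1)] row[OF V ij(2)] by simp
  finally show ?thesis .
qed

text \<open>The library states associativity with carriers, which leaves inner dimensions
  undetermined in conditional rewriting.\<close>

lemma mult_assoc_dim:
  fixes A B C :: "'a :: semiring_0 mat"
  shows "dim_col A = dim_row B \<Longrightarrow> dim_col B = dim_row C \<Longrightarrow> A * B * C = A * (B * C)"
  by (rule assoc_mult_mat[of _ "dim_row A" "dim_row B" _ "dim_row C" _ "dim_col C"]) auto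

section \<open>Principal submatrices\<close>

text \<open>Column \<open>j\<close> is the unit vector of index \<open>f j\<close>. Indexing by
  functions instead of sets records the order of the selected indices, so permutations, their first
  \<open>p\<close> values and bordered index lists are all of one kind.\<close>

definition embed_mat :: "nat \<Rightarrow> nat \<Rightarrow> (nat \<Rightarrow> nat) \<Rightarrow> real mat" where
  "embed_mat n k f = mat n k (\<lambda>(i,j). if i = f j then 1 else 0)"

definition principal_sub :: "nat \<Rightarrow> (nat \<Rightarrow> nat) \<Rightarrow> real mat \<Rightarrow> real mat" where
  "principal_sub k f M = mat k k (\<lambda>(i,j). M $$ (f i, f j))"

lemma embed_mat_carrier [simp]: "embed_mat n k f \<in> carrier_mat n k"
  unfolding embed_mat_def by simp

lemma dim_embed_mat [simp]: "dim_row (embed_mat n k f) = n" "dim_col (embed_mat n k f) = k"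
  unfolding embed_mat_def by simp_all

lemma principal_sub_carrier [simp]: "principal_sub k f M \<in> carrier_mat k k"
  unfolding principal_sub_def by simp

lemma mult_embed_mat:
  assumes X: "X \<in> carrier_mat m n" and f: "f \<in> {..<k} \<rightarrow> {..<n}"
  shows "X * embed_mat n k f = mat m k (\<lambda>(i,j). X $$ (i, f j))"
proof (rule eq_matI)
  fix i j assume "i < dim_row (mat m k (\<lambda>(i,j). X $$ (i, f j)))" "j < dim_col (mat m k (\<lambda>(i,j). X $$ (i, f j)))"
  then have ij: "i < m" "j < k" by auto
  have "(X * embed_mat n k f) $$ (i,j) = (\<Sum>l<n. X $$ (i,l) * (if l = f j then 1 else 0))"
    using ij X unfolding embed_mat_def by (simp add: scalar_prod_def atLeast0LessThan)
  also have "\<dots> = (\<Sum>l<n. if l = f j then X $$ (i,l) else 0)" by (intro sum.cong) auto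
  also have "\<dots> = X $$ (i, f j)" using f ij(2) by (auto simp: Pi_iff)
  finally show "(X * embed_mat n k f) $$ (i,j) = mat m k (\<lambda>(i,j). X $$ (i, f j)) $$ (i,j)"
    using ij by simp
qed (use X in \<open>auto simp: embed_mat_def\<close>)

lemma embed_mat_transpose_mult:
  assumes X: "X \<in> carrier_mat n m" and f: "f \<in> {..<k} \<rightarrow> {..<n}"
  shows "(embed_mat n k f)\<^sup>T * X = mat k m (\<lambda>(i,j). X $$ (f i, j))"
proof -
  have "((embed_mat n k f)\<^sup>T * X)\<^sup>T = X\<^sup>T * embed_mat n k f"
    using X by (simp add: transpose_mult[of _ k n _ m])
  also have "\<dots> = mat m k (\<lambda>(i,j). X\<^sup>T $$ (i, f j))"
    using X f by (intro mult_embed_mat) auto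
  also have "\<dots> = (mat k m (\<lambda>(i,j). X $$ (f i, j)))\<^sup>T"
    using X f by (intro eq_matI) (auto simp: Pi_iff)
  finally show ?thesis by simp
qed

lemma embed_mat_conj:
  assumes M: "M \<in> carrier_mat n n" and f: "f \<in> {..<k} \<rightarrow> {..<n}"
  shows "(embed_mat n k f)\<^sup>T * M * embed_mat n k f = principal_sub k f M"
  using f M unfolding embed_mat_transpose_mult[OF M f]
  by (subst mult_embed_mat[of _ k n]) (auto simp: principal_sub_def Pi_iff intro!: eq_matI)

lemma embed_mat_isometry:
  assumes f: "f \<in> {..<k} \<rightarrow> {..<n}" and inj: "inj_on f {..<k}"
  shows "(embed_mat n k f)\<^sup>T * embed_mat n k f = 1\<^sub>m k"
  using f inj unfolding embed_mat_transpose_mult[OF embed_mat_carrier f]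
  by (auto simp: embed_mat_def inj_on_def Pi_iff intro!: eq_matI)

lemma principal_sub_symmetric:
  assumes M: "M \<in> carrier_mat n n" "M\<^sup>T = M" and f: "f \<in> {..<k} \<rightarrow> {..<n}"
  shows "(principal_sub k f M)\<^sup>T = principal_sub k f M"
  unfolding embed_mat_conj[OF M(1) f, symmetric] by (rule symmetric_conj(1)[OF M embed_mat_carrier])

lemma conj_quadratic_form:
  fixes M J :: "real mat"
  assumes M: "M \<in> carrier_mat n n" and J: "J \<in> carrier_mat n k" and w: "w \<in> carrier_vec k"
  shows "w \<bullet> ((J\<^sup>T * M * J) *\<^sub>v w) = (J *\<^sub>v w) \<bullet> (M *\<^sub>v (J *\<^sub>v w))"
proof -
  let ?y = "M *\<^sub>v (J *\<^sub>v w)"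
  have y: "?y \<in> carrier_vec n" using M J w by (simp add: mult_mat_vec_carrier[of _ n n])
  have *: "(J\<^sup>T * M * J) *\<^sub>v w = J\<^sup>T *\<^sub>v ?y"
    using M J w by (simp add: mult_carrier_mat[of _ n n _ k] assoc_mult_mat[of _ k n _ n _ k]
        assoc_mult_mat_vec[of _ k n _ k] assoc_mult_mat_vec[of _ n n _ k])
  have "w \<bullet> ((J\<^sup>T * M * J) *\<^sub>v w) = (J\<^sup>T *\<^sub>v ?y) \<bullet> w"
    unfolding * using J w y by (intro comm_scalar_prod[of _ k]) auto
  also have "\<dots> = ?y \<bullet> (J *\<^sub>v w)" by (rule transpose_vec_mult_scalar[OF J w y])
  also have "\<dots> = (J *\<^sub>v w) \<bullet> ?y" using J w y by (intro comm_scalar_prod[of _ n]) auto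
  finally show ?thesis .
qed

lemma principal_sub_pos_def:
  assumes M: "M \<in> carrier_mat n n" and pd: "pos_def_mat M"
    and f: "f \<in> {..<k} \<rightarrow> {..<n}" and inj: "inj_on f {..<k}"
  shows "pos_def_mat (principal_sub k f M)"
  unfolding pos_def_mat_def
proof (intro ballI impI)
  let ?J = "embed_mat n k f"
  fix w :: "real vec" assume "w \<in> carrier_vec (dim_row (principal_sub k f M))"
    and "w \<noteq> 0\<^sub>v (dim_row (principal_sub k f M))"
  then have w: "w \<in> carrier_vec k" "w \<noteq> 0\<^sub>v k" unfolding principal_sub_def by auto
  have "(?J *\<^sub>v w) \<bullet> (?J *\<^sub>v w) > 0"
    using orthonormal_cols_isometry[OF embed_mat_carrier embed_mat_isometry[OF f inj] w(1)]
      conjugate_square_greater_0_vec[of w k] w by simp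
  then have "?J *\<^sub>v w \<noteq> 0\<^sub>v n" by auto
  moreover have "?J *\<^sub>v w \<in> carrier_vec n"
    using w by (simp add: mult_mat_vec_carrier[of _ n k])
  ultimately have "(?J *\<^sub>v w) \<bullet> (M *\<^sub>v (?J *\<^sub>v w)) > 0"
    using pd M unfolding pos_def_mat_def by auto
  then show "w \<bullet> (principal_sub k f M *\<^sub>v w) > 0"
    unfolding embed_mat_conj[OF M f, symmetric]
      conj_quadratic_form[OF M embed_mat_carrier w(1)] .
qed

lemma pos_def_imp_psd:
  assumes "A \<in> carrier_mat n n" "pos_def_mat A" "v \<in> carrier_vec n"
  shows "0 \<le> v \<bullet> (A *\<^sub>v v)"
  using assms unfolding pos_def_mat_def by (cases "v = 0\<^sub>v n") (auto simp: less_imp_le)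

lemma pos_def_det_pos:
  assumes A: "A \<in> carrier_mat n n" "A\<^sup>T = A" and pd: "pos_def_mat A"
  shows "0 < det A"
  unfolding det_eq_prod_eigval[OF A] using eigval_pos[OF A _ _ pd] by (intro prod_pos) auto

text \<open>The adjugate divided by the determinant. The cofactor form of the entries is what later
  lets maximality of a determinant rank the diagonal entries of an inverse.\<close>

lemma inverse_mat_exists:
  fixes A :: "real mat"
  assumes A: "A \<in> carrier_mat n n" and "det A \<noteq> 0"
  obtains B where "B \<in> carrier_mat n n" "A * B = 1\<^sub>m n" "B * A = 1\<^sub>m n"
    "\<And>i j. i < n \<Longrightarrow> j < n \<Longrightarrow> B $$ (i,j) = cofactor A j i / det A"
proof -
  let ?B = "(1 / det A) \<cdot>\<^sub>m adj_mat A"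
  note adj = adj_mat[OF A]
  have inv: "A * ?B = 1\<^sub>m n" "?B * A = 1\<^sub>m n"
    using adj A assms(2) by (auto simp: mult_smult_distrib[of _ n n] mult_smult_assoc_mat[of _ n n])
  have entry: "?B $$ (i,j) = cofactor A j i / det A" if "i < n" "j < n" for i j
    using that A unfolding adj_mat_def by simp
  have "?B \<in> carrier_mat n n" using adj(1) by simp
  from that[OF this inv entry] show thesis .
qed

lemma scalar_unit_mult_unit:
  fixes E :: "real mat"
  assumes "E \<in> carrier_mat n n" "i < n" "j < n"
  shows "unit_vec n i \<bullet> (E *\<^sub>v unit_vec n j) = E $$ (i,j)"
  using assms by simp

lemma psd_entry_le:
  fixes E :: "real mat"
  assumes E: "E \<in> carrier_mat n n" "E\<^sup>T = E"
    and psd: "\<And>v. v \<in> carrier_vec n \<Longrightarrow> 0 \<le> v \<bullet> (E *\<^sub>v v)" and ij: "i < n" "j < n"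
  shows "\<bar>E $$ (i,j)\<bar> \<le> (E $$ (i,i) + E $$ (j,j)) / 2"
proof -
  have sym: "E $$ (j,i) = E $$ (i,j)"
    using ij E by (metis carrier_matD index_transpose_mat(1))
  have "0 \<le> E $$ (i,i) + 2 * s * E $$ (i,j) + s * s * E $$ (j,j)" for s
  proof -
    let ?e = "\<lambda>i. unit_vec n i :: real vec"
    let ?v = "?e i + s \<cdot>\<^sub>v ?e j"
    have Ec: "E *\<^sub>v ?e l \<in> carrier_vec n" for l using E by (simp add: mult_mat_vec_carrier[of _ n n])
    have "E *\<^sub>v ?v = E *\<^sub>v ?e i + s \<cdot>\<^sub>v (E *\<^sub>v ?e j)"
      using E by (simp add: mult_add_distrib_mat_vec[of _ n n] mult_mat_vec[of _ n n])
    then have "?v \<bullet> (E *\<^sub>v ?v) = E $$ (i,i) + s * E $$ (j,i) + s * (E $$ (i,j) + s * E $$ (j,j))"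
      using Ec ij
      by (simp add: add_scalar_prod_distrib[of _ n] scalar_prod_add_distrib[of _ n]
          smult_scalar_prod_distrib[of _ n] scalar_prod_smult_distrib[of _ n]
          scalar_unit_mult_unit[OF E(1)] del: scalar_prod_left_unit)
    also have "\<dots> = E $$ (i,i) + 2 * s * E $$ (i,j) + s * s * E $$ (j,j)"
      unfolding sym by (simp add: algebra_simps)
    finally show ?thesis using psd[of ?v] by simp
  qed
  \<comment> \<open>The two sign choices bound the entry from below and from above.\<close>
  from this[of 1] this[of "-1"] show ?thesis by simp
qed

section \<open>The error of a principal skeleton approximation\<close>

text \<open>The parameter \<open>B\<close> is the inverse of the selected submatrix, so the
  estimates involve no pseudoinverse; the link with \<open>moore_penrose\<close> is made
  separately.\<close>

locale principal_skeleton =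
  fixes M :: "real mat" and n p :: nat and f :: "nat \<Rightarrow> nat" and B :: "real mat"
  assumes M: "M \<in> carrier_mat n n" and sym: "M\<^sup>T = M" and pd: "pos_def_mat M"
    and f: "f \<in> {..<p} \<rightarrow> {..<n}" and inj: "inj_on f {..<p}"
    and B: "B \<in> carrier_mat p p" and BA: "B * principal_sub p f M = 1\<^sub>m p"
begin

abbreviation "A \<equiv> principal_sub p f M"
abbreviation "J \<equiv> embed_mat n p f"

text \<open>The inverse of \<open>A\<close> placed at the selected rows and columns, with zeros
  elsewhere.\<close>

definition "Q = J * B * J\<^sup>T"
definition "S = M * Q * M"
definition "E = M - S"

lemma J: "J \<in> carrier_mat n p" by simp

lemma A: "J\<^sup>T * M * J = A" by (rule embed_mat_conj[OF M f])

lemma symA: "A\<^sup>T = A" by (rule principal_sub_symmetric[OF M sym f])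

lemma AB: "A * B = 1\<^sub>m p" by (rule mat_mult_left_right_inverse[OF B _ BA]) simp

lemma symB: "B\<^sup>T = B"
proof -
  have "B\<^sup>T * A = (A * B)\<^sup>T" using B symA by (simp add: transpose_mult[of _ p p _ p])
  then have BTA: "B\<^sup>T * A = 1\<^sub>m p" unfolding AB by simp
  have "B\<^sup>T = B\<^sup>T * (A * B)" unfolding AB using B by simp
  also have "\<dots> = (B\<^sup>T * A) * B" by (rule assoc_mult_mat[symmetric]) (use B in auto)
  also have "\<dots> = B" unfolding BTA using B by simp
  finally show ?thesis .
qed

lemma Q: "Q \<in> carrier_mat n n" "Q\<^sup>T = Q"
proof -
  show "Q \<in> carrier_mat n n" unfolding Q_def by (rule mult_carrier_mat[of _ n p]) (use B in \<open>auto intro: mult_carrier_mat[of _ n p]\<close>)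
  show "Q\<^sup>T = Q"
    using symmetric_conj(1)[OF B symB, of "J\<^sup>T" n] unfolding Q_def by simp
qed

text \<open>The inner factor \<open>J\<^sup>T * M * J\<close> collapses to \<open>A\<close>, which
  cancels against \<open>B\<close>. It follows that the form of \<open>Q\<close> at \<open>y\<close>
  is the form of \<open>M\<close> at \<open>Q *\<^sub>v y\<close>, hence nonnegative.\<close>

lemma QMQ: "Q * M * Q = Q"
proof -
  have BJ: "B * J\<^sup>T \<in> carrier_mat p n" using B by (auto intro: mult_carrier_mat[of _ _ p])
  have "Q * M * Q = J * (B * ((J\<^sup>T * M * J) * (B * J\<^sup>T)))"
    unfolding Q_def using carrier_matD[OF B] carrier_matD[OF M]
    by (simp add: mult_assoc_dim del: assoc_mult_mat)
  also have "\<dots> = J * ((B * A) * (B * J\<^sup>T))"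
    unfolding A using B BJ by (simp add: assoc_mult_mat[of _ p p _ p _ n])
  also have "\<dots> = Q" unfolding BA Q_def using B BJ
    by (simp add: assoc_mult_mat[of _ n p _ p _ n] left_mult_one_mat[of _ p n])
  finally show ?thesis .
qed

lemma S: "S \<in> carrier_mat n n" "S\<^sup>T = S"
  using symmetric_conj[OF Q M] unfolding S_def sym by auto

lemma E: "E \<in> carrier_mat n n" "E\<^sup>T = E"
  using S M sym unfolding E_def by (auto simp: transpose_minus[of _ n n])

lemma S_quadratic_form:
  assumes v: "v \<in> carrier_vec n"
  shows "v \<bullet> (S *\<^sub>v v) = (M *\<^sub>v v) \<bullet> (Q *\<^sub>v (M *\<^sub>v v))"
  using conj_quadratic_form[OF Q(1) M v] unfolding S_def sym .

lemma Q_quadratic_form: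
  assumes y: "y \<in> carrier_vec n"
  shows "y \<bullet> (Q *\<^sub>v y) = (Q *\<^sub>v y) \<bullet> (M *\<^sub>v (Q *\<^sub>v y))"
  using conj_quadratic_form[OF M Q(1) y] unfolding Q(2) QMQ .

lemma S_psd:
  assumes v: "v \<in> carrier_vec n"
  shows "0 \<le> v \<bullet> (S *\<^sub>v v)"
  unfolding S_quadratic_form[OF v] using M v Q
  by (subst Q_quadratic_form) (auto intro!: pos_def_imp_psd[OF M pd] mult_mat_vec_carrier[of _ n n])

text \<open>Completing the square: the form of \<open>E\<close> at \<open>v\<close> is the form of
  \<open>M\<close> at \<open>v - q\<close>, where \<open>q = Q *\<^sub>v (M *\<^sub>v v)\<close> is
  the projection of \<open>v\<close> onto the selected coordinates that is orthogonal with respect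
  to \<open>M\<close>.\<close>

lemma E_psd:
  assumes v: "v \<in> carrier_vec n"
  shows "0 \<le> v \<bullet> (E *\<^sub>v v)"
proof -
  let ?y = "M *\<^sub>v v"
  let ?q = "Q *\<^sub>v ?y"
  have y: "?y \<in> carrier_vec n" using M v by (simp add: mult_mat_vec_carrier[of _ n n])
  have q: "?q \<in> carrier_vec n" using Q y by (simp add: mult_mat_vec_carrier[of _ n n])
  have Mq: "M *\<^sub>v ?q \<in> carrier_vec n" using M q by (simp add: mult_mat_vec_carrier[of _ n n])
  have cross: "v \<bullet> (M *\<^sub>v ?q) = ?y \<bullet> ?q"
    using transpose_vec_mult_scalar[OF M q v] unfolding sym by simp
  have "0 \<le> (v - ?q) \<bullet> (M *\<^sub>v (v - ?q))"
    using v q by (intro pos_def_imp_psd[OF M pd]) simp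
  also have "M *\<^sub>v (v - ?q) = ?y - M *\<^sub>v ?q"
    using M v q by (simp add: mult_minus_distrib_mat_vec[of _ n n])
  also have "(v - ?q) \<bullet> (?y - M *\<^sub>v ?q)
      = v \<bullet> ?y - v \<bullet> (M *\<^sub>v ?q) - (?q \<bullet> ?y - ?q \<bullet> (M *\<^sub>v ?q))"
    using v q y Mq by (simp add: minus_scalar_prod_distrib[of _ n] scalar_prod_minus_distrib[of _ n])
  also have "\<dots> = v \<bullet> ?y - ?y \<bullet> ?q"
    unfolding cross Q_quadratic_form[OF y, symmetric] comm_scalar_prod[OF q y] by simp
  also have "\<dots> = v \<bullet> ?y - v \<bullet> (S *\<^sub>v v)"
    unfolding S_quadratic_form[OF v] by simp
  also have "\<dots> = v \<bullet> (E *\<^sub>v v)"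
    unfolding E_def using M S v
    by (simp add: minus_mult_distrib_mat_vec[of _ n n] scalar_prod_minus_distrib[of _ n]
        mult_mat_vec_carrier[of _ n n])
  finally show ?thesis .
qed

lemma S_le:
  assumes v: "v \<in> carrier_vec n"
  shows "v \<bullet> (S *\<^sub>v v) \<le> v \<bullet> (M *\<^sub>v v)"
  using E_psd[OF v] M S v unfolding E_def
  by (simp add: minus_mult_distrib_mat_vec[of _ n n] scalar_prod_minus_distrib[of _ n]
      mult_mat_vec_carrier[of _ n n])

text \<open>A skeleton approximation reproduces the columns it was built from, again because
  \<open>B\<close> cancels \<open>A\<close>. Both the vanishing error columns and the compression of
  \<open>S\<close> to \<open>A\<close> follow.\<close>

lemma SJ: "S * J = M * J"
proof -
  note MJ = mult_carrier_mat[OF M J]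
  note MJB = mult_carrier_mat[OF MJ B]
  have "S * J = M * J * B * (J\<^sup>T * M * J)"
    unfolding S_def Q_def using carrier_matD[OF B] carrier_matD[OF M]
    by (simp add: mult_assoc_dim del: assoc_mult_mat)
  also have "\<dots> = M * J * (B * A)"
    unfolding A using MJ MJB B by (intro assoc_mult_mat[of _ n p _ p _ p]) auto
  also have "\<dots> = M * J" unfolding BA using MJ by (rule right_mult_one_mat)
  finally show ?thesis .
qed

lemma principal_sub_S: "J\<^sup>T * S * J = A"
proof -
  have "J\<^sup>T * S * J = J\<^sup>T * (S * J)" using S by (intro assoc_mult_mat[of _ p n _ n _ p]) auto
  also have "\<dots> = J\<^sup>T * M * J" unfolding SJ using M by (intro assoc_mult_mat[symmetric, of _ p n _ n _ p]) auto
  finally show ?thesis unfolding A .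
qed

lemma E_col:
  assumes "i < n" "a < p"
  shows "E $$ (i, f a) = 0"
proof -
  have "(S * J) $$ (i,a) = S $$ (i, f a)" "(M * J) $$ (i,a) = M $$ (i, f a)"
    using assms mult_embed_mat[OF S(1) f] mult_embed_mat[OF M f] by auto
  then show ?thesis unfolding E_def SJ using S M assms f by (auto simp: Pi_iff)
qed

text \<open>\<open>Q\<close> sees only the selected coordinates of \<open>M *\<^sub>v y\<close>; if
  these vanish, \<open>S\<close> annihilates \<open>y\<close>. This reduces an error entry to a
  linear system for the bordered submatrix.\<close>

lemma E_mult_vec:
  assumes y: "y \<in> carrier_vec n" and 0: "\<And>a. a < p \<Longrightarrow> (M *\<^sub>v y) $ (f a) = 0"
  shows "E *\<^sub>v y = M *\<^sub>v y"
proof -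
  have My: "M *\<^sub>v y \<in> carrier_vec n" using M y by (simp add: mult_mat_vec_carrier[of _ n n])
  have "J\<^sup>T *\<^sub>v (M *\<^sub>v y) = 0\<^sub>v p"
  proof (rule eq_vecI)
    fix a assume a: "a < dim_vec (0\<^sub>v p :: real vec)"
    then have "(J\<^sup>T *\<^sub>v (M *\<^sub>v y)) $ a = (\<Sum>l<n. (if l = f a then 1 else 0) * (M *\<^sub>v y) $ l)"
      using M y by (simp add: scalar_prod_def atLeast0LessThan embed_mat_def)
    also have "\<dots> = (\<Sum>l<n. if l = f a then (M *\<^sub>v y) $ l else 0)" by (intro sum.cong) auto
    finally show "(J\<^sup>T *\<^sub>v (M *\<^sub>v y)) $ a = 0\<^sub>v p $ a" using a f 0 by (auto simp: Pi_iff)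
  qed (simp add: embed_mat_def)
  then have "Q *\<^sub>v (M *\<^sub>v y) = J *\<^sub>v (B *\<^sub>v 0\<^sub>v p)"
    unfolding Q_def using B My
    by (simp add: assoc_mult_mat_vec[of _ n p _ n] assoc_mult_mat_vec[of _ n p _ p]
        mult_carrier_mat[of _ n p _ p] mult_mat_vec_carrier[of _ p n])
  also have "B *\<^sub>v 0\<^sub>v p = 0\<^sub>v p" by (rule eq_vecI) (use B in auto)
  also have "J *\<^sub>v 0\<^sub>v p = 0\<^sub>v n" by (rule eq_vecI) (auto simp: embed_mat_def)
  finally have "Q *\<^sub>v (M *\<^sub>v y) = 0\<^sub>v n" .
  moreover have "M *\<^sub>v 0\<^sub>v n = 0\<^sub>v n" by (rule eq_vecI) (use M in auto)
  ultimately have "S *\<^sub>v y = 0\<^sub>v n"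
    unfolding S_def using M Q y
    by (simp add: assoc_mult_mat_vec[of _ n n _ n] mult_carrier_mat[of _ n n _ n]
        mult_mat_vec_carrier[of _ n n])
  then show ?thesis unfolding E_def using M S y My
    by (simp add: minus_mult_distrib_mat_vec[of _ n n])
qed

end

section \<open>Bordered submatrices and the diagonal of the error\<close>

text \<open>\<open>insert_index j\<close> skips \<open>j\<close>, so a diagonal minor is again a
  principal submatrix and a competitor for the maximal determinant.\<close>

lemma mat_delete_principal_sub:
  assumes "j < Suc k"
  shows "mat_delete (principal_sub (Suc k) g M) j j = principal_sub k (g \<circ> insert_index j) M"
  unfolding mat_delete_def principal_sub_def insert_index_def using assms
  by (intro eq_matI) auto

context principal_skeleton
begin

text \<open>With \<open>K\<close> the submatrix bordered by the index \<open>i\<close>, the last diagonal entry of \<open>K\<^sup>-\<^sup>1\<close>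
  is \<open>1 / E\<^sub>i\<^sub>i\<close> and, by Cramer's rule and maximality of \<open>det A\<close>, the largest one; hence
  \<open>1 / E\<^sub>i\<^sub>i \<ge> tr K\<^sup>-\<^sup>1 / (p + 1)\<close>, and interlacing bounds the trace from below.\<close>

lemma E_diag_le:
  assumes max: "\<And>g. g \<in> {..<p} \<rightarrow> {..<n} \<Longrightarrow> inj_on g {..<p} \<Longrightarrow> det (principal_sub p g M) \<le> det A"
    and i: "i < n" "i \<notin> f ` {..<p}" and pn: "p < n"
  shows "E $$ (i,i) \<le> real (p + 1) / (\<Sum>k=1..p+1. inverse (eigval M k))"
proof -
  \<comment> \<open>The new index comes last, at position \<open>p\<close>, so that deleting the
    last row and column of \<open>K\<close> gives back \<open>A\<close>.\<close>
  define g where "g j = (if j < p then f j else i)" for j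
  have g: "g \<in> {..<Suc p} \<rightarrow> {..<n}" using f i(1) unfolding g_def by (auto simp: Pi_iff)
  have ginj: "inj_on g {..<Suc p}"
    using inj i(2) unfolding g_def inj_on_def by (auto simp: less_Suc_eq)
  define K where "K = principal_sub (Suc p) g M"
  let ?G = "embed_mat n (Suc p) g"
  have K: "K \<in> carrier_mat (Suc p) (Suc p)" unfolding K_def by simp
  have GMG: "?G\<^sup>T * M * ?G = K" unfolding K_def by (rule embed_mat_conj[OF M g])
  have symK: "K\<^sup>T = K" unfolding K_def by (rule principal_sub_symmetric[OF M sym g])
  have pdK: "pos_def_mat K" unfolding K_def by (rule principal_sub_pos_def[OF M pd g ginj])
  have detK: "0 < det K" by (rule pos_def_det_pos[OF K symK pdK])
  obtain C where C: "C \<in> carrier_mat (Suc p) (Suc p)" "K * C = 1\<^sub>m (Suc p)" "C * K = 1\<^sub>m (Suc p)"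
    and Cij: "\<And>i j. i < Suc p \<Longrightarrow> j < Suc p \<Longrightarrow> C $$ (i,j) = cofactor K j i / det K"
    using inverse_mat_exists[OF K] detK by (metis less_irrefl)
  \<comment> \<open>On the diagonal the cofactor sign is an even power of -1.\<close>
  have Cdiag: "C $$ (j,j) = det (principal_sub p (g \<circ> insert_index j) M) / det K" if "j < Suc p" for j
    using Cij[OF that that] mat_delete_principal_sub[OF that, of g M]
    unfolding cofactor_def K_def by simp
  have Cpp: "C $$ (p,p) = det A / det K"
  proof -
    have "principal_sub p (g \<circ> insert_index p) M = A"
      unfolding principal_sub_def by (intro eq_matI) (auto simp: g_def)
    then show ?thesis using Cdiag[of p] by simp
  qed
  have "0 < det A"
    by (rule pos_def_det_pos[OF principal_sub_carrier symA principal_sub_pos_def[OF M pd f inj]])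
  then have Cpos: "0 < C $$ (p,p)" unfolding Cpp using detK by simp
  have Cmax: "C $$ (j,j) \<le> C $$ (p,p)" if j: "j < Suc p" for j
  proof -
    have ii: "insert_index j a < Suc p" if "a < p" for a
      using that unfolding insert_index_def by auto
    have "g \<circ> insert_index j \<in> {..<p} \<rightarrow> {..<n}" using g ii by (auto simp: Pi_iff)
    moreover have "inj_on (g \<circ> insert_index j) {..<p}"
      using ginj ii by (intro comp_inj_on insert_index_inj_on inj_on_subset[OF ginj]) auto
    ultimately show ?thesis
      unfolding Cdiag[OF j] Cpp using detK max by (intro divide_right_mono) auto
  qed
  have pos: "0 < eigval M k" if "1 \<le> k" "k \<le> n" for k by (rule eigval_pos[OF M sym that pd])
  have Kpos: "0 < eigval K k" if "1 \<le> k" "k \<le> Suc p" for k by (rule eigval_pos[OF K symK that pdK])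
  have "eigval K k \<le> eigval M k" if "1 \<le> k" "k \<le> Suc p" for k
    by (rule eigval_compression_le[OF M sym K symK embed_mat_carrier embed_mat_isometry[OF g ginj]])
      (use that pn conj_quadratic_form[OF M embed_mat_carrier, of _ "Suc p" g] GMG in auto)
  \<comment> \<open>Interlacing bounds the eigenvalues of \<open>K\<close> from above, and taking
    reciprocals of positive numbers reverses this into a lower bound for the trace of
    \<open>C\<close>.\<close>
  then have "(\<Sum>k=1..p+1. inverse (eigval M k)) \<le> (\<Sum>k=1..Suc p. inverse (eigval K k))"
    unfolding Suc_eq_plus1[symmetric]
    by (intro sum_mono le_imp_inverse_le) (auto intro: Kpos)
  also have "\<dots> = (\<Sum>j<Suc p. C $$ (j,j))"
    by (rule sum_diag_inverse[OF K symK C(1,3), symmetric]) (use Kpos in force)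
  also have "\<dots> \<le> (\<Sum>j<Suc p. C $$ (p,p))" by (intro sum_mono Cmax) simp
  finally have trace: "(\<Sum>k=1..p+1. inverse (eigval M k)) \<le> real (p + 1) * C $$ (p,p)" by simp
  \<comment> \<open>\<open>z\<close> solves \<open>K *\<^sub>v z = unit_vec (Suc p) p\<close>, and
    \<open>y\<close> extends it by zeros. Then \<open>M *\<^sub>v y\<close> vanishes at the old
    indices and is 1 at \<open>i\<close>.\<close>
  define z where "z = col C p"
  define y where "y = ?G *\<^sub>v z"
  have z: "z \<in> carrier_vec (Suc p)" unfolding z_def using C(1) by (auto simp: carrier_vecI)
  have y: "y \<in> carrier_vec n" unfolding y_def using z by (simp add: mult_mat_vec_carrier[of _ n "Suc p"])
  have My: "(M *\<^sub>v y) $ g a = (if a = p then 1 else 0)" if a: "a < Suc p" for a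
  proof -
    have MG: "M * ?G = mat n (Suc p) (\<lambda>(i,j). M $$ (i, g j))" by (rule mult_embed_mat[OF M g])
    have "M *\<^sub>v y = (M * ?G) *\<^sub>v z"
      unfolding y_def using M z by (simp add: assoc_mult_mat_vec[of _ n n _ "Suc p"])
    then have "(M *\<^sub>v y) $ g a = (K *\<^sub>v z) $ a"
      using a g K z unfolding MG by (auto simp: K_def principal_sub_def Pi_iff scalar_prod_def)
    also have "K *\<^sub>v z = col (K * C) p"
      unfolding z_def using K C(1) by (intro col_mult2[symmetric, of _ "Suc p" "Suc p" _ "Suc p"]) auto
    finally show ?thesis unfolding C(2) using a by auto
  qed
  have "E *\<^sub>v y = M *\<^sub>v y"
  proof (rule E_mult_vec[OF y])
    fix a assume "a < p"
    then show "(M *\<^sub>v y) $ f a = 0" using My[of a] by (simp add: g_def)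
  qed
  then have one: "(E *\<^sub>v y) $ i = 1" using My[of p] by (simp add: g_def)
  have "E *\<^sub>v y = (E * ?G) *\<^sub>v z"
    unfolding y_def using E z by (simp add: assoc_mult_mat_vec[of _ n n _ "Suc p"])
  then have "(E *\<^sub>v y) $ i = (\<Sum>a<Suc p. E $$ (i, g a) * z $ a)"
    unfolding mult_embed_mat[OF E(1) g] using i z by (simp add: scalar_prod_def atLeast0LessThan)
  \<comment> \<open>The error columns at the old indices are zero, so only the term at position
    \<open>p\<close> survives.\<close>
  also have "\<dots> = E $$ (i,i) * z $ p"
    using i by (simp add: g_def E_col)
  also have "z $ p = C $$ (p,p)" unfolding z_def using C(1) by simp
  finally have "E $$ (i,i) * C $$ (p,p) = 1" unfolding one by simp
  then have Eii: "E $$ (i,i) = 1 / C $$ (p,p)" using Cpos by (simp add: field_simps)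
  have "0 < (\<Sum>k=1..p+1. inverse (eigval M k))"
    using pn by (intro sum_pos) (auto intro!: pos)
  then show ?thesis unfolding Eii using trace Cpos by (simp add: field_simps)
qed

lemma E_entry_le:
  assumes max: "\<And>g. g \<in> {..<p} \<rightarrow> {..<n} \<Longrightarrow> inj_on g {..<p} \<Longrightarrow> det (principal_sub p g M) \<le> det A"
    and pn: "p < n" and ij: "i < n" "j < n"
  shows "\<bar>E $$ (i,j)\<bar> \<le> real (p + 1) / (\<Sum>k=1..p+1. inverse (eigval M k))"
proof -
  let ?h = "real (p + 1) / (\<Sum>k=1..p+1. inverse (eigval M k))"
  have "0 \<le> (\<Sum>k=1..p+1. inverse (eigval M k))"
    using pn by (intro sum_nonneg) (auto intro!: less_imp_le[OF eigval_pos[OF M sym _ _ pd]])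
  \<comment> \<open>At a selected index the diagonal error is zero, and the bound there is just this
    sign.\<close>
  then have h: "0 \<le> ?h" by (intro divide_nonneg_nonneg) auto
  have "E $$ (l,l) \<le> ?h" if l: "l < n" for l
  proof (cases "l \<in> f ` {..<p}")
    case True
    then show ?thesis using E_col[OF l] h by force
  next
    case False
    then show ?thesis using E_diag_le[OF max l _ pn] by simp
  qed
  from this[OF ij(1)] this[OF ij(2)] show ?thesis
    using psd_entry_le[OF E _ ij] E_psd by fastforce
qed

end

section \<open>Permutations, rank and the truncated approximation\<close>

text \<open>The left inverse makes the columns of \<open>Z\<close> independent; the right inverse
  makes \<open>Y\<close> surjective, so \<open>Z * Y\<close> and \<open>Z\<close> have the same
  column space.\<close>

lemma rank_full_factorization:
  fixes Z Y L R :: "real mat"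
  assumes Z: "Z \<in> carrier_mat n r" and Y: "Y \<in> carrier_mat r m"
    and L: "L \<in> carrier_mat r n" "L * Z = 1\<^sub>m r" and R: "R \<in> carrier_mat m r" "Y * R = 1\<^sub>m r"
  shows "vec_space.rank n (Z * Y) = r"
proof -
  interpret vec_space "TYPE(real)" n .
  have Linv: "L *\<^sub>v (Z *\<^sub>v x) = x" if "x \<in> carrier_vec r" for x
    using that Z L by (simp flip: assoc_mult_mat_vec[of _ r n _ r])
  \<comment> \<open>Independence is stated for the set of columns, so repeated columns must be
    excluded: \<open>L\<close> sends them to different unit vectors.\<close>
  have dist: "distinct (cols Z)"
  proof (subst distinct_conv_nth, intro allI impI)
    fix i j assume "i < length (cols Z)" "j < length (cols Z)" "i \<noteq> j"
    then have ij: "i < r" "j < r" "i \<noteq> j" using Z by auto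
    have "col (L * Z) i \<noteq> col (L * Z) j"
      unfolding L(2) using ij by (auto simp: unit_vec_eq)
    moreover have "col (L * Z) k = L *\<^sub>v col Z k" if "k < r" for k
      using that L Z by (intro col_mult2[of _ r n _ r]) auto
    ultimately show "cols Z ! i \<noteq> cols Z ! j" using ij Z by auto
  qed
  have indpt: "lin_indpt (set (cols Z))"
  proof
    assume "lin_dep (set (cols Z))"
    then obtain v where v: "v \<in> carrier_vec r" "v \<noteq> 0\<^sub>v r" "Z *\<^sub>v v = 0\<^sub>v n"
      using lin_depE[OF Z _ dist] by blast
    have "v = L *\<^sub>v 0\<^sub>v n" using Linv[OF v(1)] v(3) by simp
    also have "\<dots> = 0\<^sub>v r" by (rule eq_vecI) (use L in auto)
    finally show False using v(2) by simp
  qed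
  have ZY: "Z * Y \<in> carrier_mat n m" using Z Y by simp
  have "(\<exists>x\<in>carrier_vec (dim_col (Z * Y)). (Z * Y) *\<^sub>v x = y)
      \<longleftrightarrow> (\<exists>x\<in>carrier_vec (dim_col Z). Z *\<^sub>v x = y)" for y
  proof
    assume "\<exists>x\<in>carrier_vec (dim_col (Z * Y)). (Z * Y) *\<^sub>v x = y"
    then obtain x where x: "x \<in> carrier_vec m" "(Z * Y) *\<^sub>v x = y" using Y by auto
    then have "Z *\<^sub>v (Y *\<^sub>v x) = y" using Z Y by simp
    moreover have "Y *\<^sub>v x \<in> carrier_vec (dim_col Z)" using Y Z x by auto
    ultimately show "\<exists>x\<in>carrier_vec (dim_col Z). Z *\<^sub>v x = y" by blast
  next
    assume "\<exists>x\<in>carrier_vec (dim_col Z). Z *\<^sub>v x = y"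
    then obtain x where x: "x \<in> carrier_vec r" "Z *\<^sub>v x = y" using Z by auto
    have "R *\<^sub>v x \<in> carrier_vec m" using R x by simp
    then have "(Z * Y) *\<^sub>v (R *\<^sub>v x) = Z *\<^sub>v (Y *\<^sub>v (R *\<^sub>v x))"
      by (rule assoc_mult_mat_vec[OF Z Y])
    also have "Y *\<^sub>v (R *\<^sub>v x) = (Y * R) *\<^sub>v x"
      by (rule assoc_mult_mat_vec[symmetric, OF Y R(1) x(1)])
    finally have "(Z * Y) *\<^sub>v (R *\<^sub>v x) = Z *\<^sub>v ((Y * R) *\<^sub>v x)" .
    then have "(Z * Y) *\<^sub>v (R *\<^sub>v x) = y" unfolding R(2) using x by simp
    moreover have "R *\<^sub>v x \<in> carrier_vec (dim_col (Z * Y))" using R Y x by auto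
    ultimately show "\<exists>x\<in>carrier_vec (dim_col (Z * Y)). (Z * Y) *\<^sub>v x = y" by blast
  qed
  then have "col_space (Z * Y) = col_space Z"
    unfolding col_space_eq[OF Z] col_space_eq[OF ZY] by simp
  then have "rank (Z * Y) = rank Z" unfolding rank_def col_space_def by simp
  also have "\<dots> = r" by (rule lin_indpt_full_rank[OF Z dist indpt])
  finally show ?thesis .
qed

section \<open>Permutation matrices and the closed form of the skeleton approximation\<close>

text \<open>The complements of the domain and of the image have equal size, so any bijection between
  them fills the gap. Maximality speaks of permutations, whereas the determinant comparison uses
  injective choices of \<open>p\<close> indices.\<close>

lemma inj_extends_to_permutation:
  assumes f: "f \<in> {..<p} \<rightarrow> {..<n}" and inj: "inj_on f {..<p}" and pn: "p \<le> (n :: nat)"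
  obtains \<pi> where "\<pi> permutes {0..<n}" "\<And>j. j < p \<Longrightarrow> \<pi> j = f j"
proof -
  have sub: "f ` {..<p} \<subseteq> {..<n}" using f by auto
  have "card ({..<n} - {..<p}) = card ({..<n} - f ` {..<p})"
    using sub pn inj by (simp add: card_Diff_subset card_image)
  then obtain h where h: "bij_betw h ({..<n} - {..<p}) ({..<n} - f ` {..<p})"
    using finite_same_card_bij[of "{..<n} - {..<p}" "{..<n} - f ` {..<p}"] by auto
  define \<pi> where "\<pi> j = (if j < p then f j else if j < n then h j else j)" for j
  have "bij_betw \<pi> ({..<p} \<union> ({..<n} - {..<p})) (f ` {..<p} \<union> ({..<n} - f ` {..<p}))"
  proof (rule bij_betw_combine)
    show "bij_betw \<pi> {..<p} (f ` {..<p})"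
      using inj_on_imp_bij_betw[OF inj] by (rule bij_betw_cong[THEN iffD1, rotated]) (auto simp: \<pi>_def)
    show "bij_betw \<pi> ({..<n} - {..<p}) ({..<n} - f ` {..<p})"
      using h by (rule bij_betw_cong[THEN iffD1, rotated]) (auto simp: \<pi>_def)
  qed auto
  moreover have "{..<p} \<union> ({..<n} - {..<p}) = {0..<n}" "f ` {..<p} \<union> ({..<n} - f ` {..<p}) = {0..<n}"
    using sub pn by auto
  ultimately have "\<pi> permutes {0..<n}"
    by (intro bij_imp_permutes) (auto simp: \<pi>_def)
  then show thesis using that by (auto simp: \<pi>_def)
qed

text \<open>The transpose enters because \<open>permutation_mat\<close> has its ones at
  \<open>(i, \<pi> i)\<close> and \<open>embed_mat\<close> at \<open>(\<pi> j, j)\<close>.\<close>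

lemma permutation_mat_embed:
  "permutation_mat n P \<longleftrightarrow> (\<exists>\<pi>. \<pi> permutes {0..<n} \<and> P = (embed_mat n n \<pi>)\<^sup>T)"
proof -
  have "mat n n (\<lambda>(i, j). if j = \<pi> i then 1 else 0) = (embed_mat n n \<pi>)\<^sup>T" for \<pi>
    unfolding embed_mat_def by (intro eq_matI) auto
  then show ?thesis unfolding permutation_mat_def by simp
qed

lemma permutes_Pi: "\<pi> permutes {0..<n :: nat} \<Longrightarrow> k \<le> n \<Longrightarrow> \<pi> \<in> {..<k} \<rightarrow> {..<n}"
  using permutes_in_image[of \<pi> "{0..<n}"] by (force simp: Pi_iff)

lemma permutes_inj_on_initial: "\<pi> permutes S \<Longrightarrow> inj_on \<pi> T"
  by (meson inj_on_subset permutes_inj subset_UNIV)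

lemma permuted_eq_principal_sub:
  assumes M: "M \<in> carrier_mat n n" and \<pi>: "\<pi> permutes {0..<n}"
  shows "(embed_mat n n \<pi>)\<^sup>T * M * ((embed_mat n n \<pi>)\<^sup>T)\<^sup>T = principal_sub n \<pi> M"
  using embed_mat_conj[OF M permutes_Pi[OF \<pi>]] by simp

lemma lead_block_eq_principal_sub:
  assumes M: "M \<in> carrier_mat n n" and \<pi>: "\<pi> permutes {0..<n}" and p: "p \<le> n"
  shows "lead_block p p M (embed_mat n n \<pi>)\<^sup>T (embed_mat n n \<pi>)\<^sup>T = principal_sub p \<pi> M"
  unfolding lead_block_def permuted_blocks_def permuted_eq_principal_sub[OF M \<pi>] split_block_def Let_def
  using p by (auto simp: principal_sub_def intro!: eq_matI)

text \<open>\<open>THE\<close> also asks for uniqueness: multiplying \<open>A * X * A = A\<close> by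
  \<open>B\<close> on both sides gives \<open>X = B\<close>.\<close>

lemma moore_penrose_eq_inverse:
  assumes A: "A \<in> carrier_mat p p" and B: "B \<in> carrier_mat p p" and AB: "A * B = 1\<^sub>m p" and BA: "B * A = 1\<^sub>m p"
  shows "moore_penrose A = B"
  unfolding moore_penrose_def
proof (rule the_equality)
  show "is_moore_penrose A B"
    unfolding is_moore_penrose_def using A B AB BA by simp
next
  fix X assume X: "is_moore_penrose A X"
  then have Xc: "X \<in> carrier_mat p p" and AXA: "A * X * A = A"
    unfolding is_moore_penrose_def using A by auto
  have AX: "A * X \<in> carrier_mat p p" using A Xc by simp
  have "X = (B * A) * X * (A * B)" unfolding AB BA using Xc by simp
  also have "\<dots> = B * (A * X * A) * B"
    using A B Xc by (simp add: assoc_mult_mat[of _ p p _ p _ p] mult_carrier_mat[of _ p p _ p])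
  also have "\<dots> = B" unfolding AXA BA using B by simp
  finally show "X = B" .
qed

text \<open>With \<open>?T\<close> for the permutation, the block column is
  \<open>?T\<^sup>T * (M * ?J)\<close> and the block row is \<open>?J\<^sup>T * M * ?T\<close>, so
  the outer permutations cancel.\<close>

lemma pseudo_skeleton_eq:
  assumes M: "M \<in> carrier_mat n n" and \<pi>: "\<pi> permutes {0..<n}" and p: "p \<le> n"
    and B: "B \<in> carrier_mat p p" and AB: "principal_sub p \<pi> M * B = 1\<^sub>m p"
    and BA: "B * principal_sub p \<pi> M = 1\<^sub>m p"
  shows "pseudo_skeleton p p M (embed_mat n n \<pi>)\<^sup>T (embed_mat n n \<pi>)\<^sup>T
    = M * (embed_mat n p \<pi> * B * (embed_mat n p \<pi>)\<^sup>T) * M"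
proof -
  let ?T = "embed_mat n n \<pi>" and ?J = "embed_mat n p \<pi>" and ?I = "embed_mat n p id"
  let ?N = "principal_sub n \<pi> M" and ?A = "principal_sub p \<pi> M"
  have T: "?T \<in> carrier_mat n n" and J: "?J \<in> carrier_mat n p" and N: "?N \<in> carrier_mat n n" by simp_all
  have id: "id \<in> {..<p} \<rightarrow> {..<n}" using p by auto
  have \<pi>n: "\<pi> \<in> {..<n} \<rightarrow> {..<n}" by (rule permutes_Pi[OF \<pi>]) simp
  have TT: "?T * ?T\<^sup>T = 1\<^sub>m n"
    by (rule mat_mult_left_right_inverse[OF _ T embed_mat_isometry[OF \<pi>n permutes_inj_on_initial[OF \<pi>]]]) simp
  \<comment> \<open>\<open>?I\<close> selects the first \<open>p\<close> coordinates; following it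
    by the permutation selects the indices of the leading block.\<close>
  have TI: "?T * ?I = ?J"
    using p unfolding mult_embed_mat[OF T id] by (auto simp: embed_mat_def intro!: eq_matI)
  have NT: "?N = ?T\<^sup>T * M * ?T" by (rule embed_mat_conj[OF M \<pi>n, symmetric])
  obtain A' Bb C D where blocks: "split_block ?N p p = (A', Bb, C, D)" by (cases "split_block ?N p p")
  then have A': "A' = ?A" and Bb: "Bb = mat p (n - p) (\<lambda>(i,j). ?N $$ (i, j + p))"
    and C: "C = mat (n - p) p (\<lambda>(i,j). ?N $$ (i + p, j))"
    using p unfolding split_block_def Let_def by (auto simp: principal_sub_def intro!: eq_matI)
  have "A' @\<^sub>r C = ?N * ?I"
    unfolding mult_embed_mat[OF N id] A' C append_rows_def using p
    by (intro eq_matI) (auto simp: principal_sub_def)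
  also have "\<dots> = ?T\<^sup>T * (M * ?J)"
    unfolding NT TI[symmetric] using carrier_matD[OF M]
    by (simp add: mult_assoc_dim del: assoc_mult_mat)
  finally have col: "A' @\<^sub>r C = ?T\<^sup>T * (M * ?J)" .
  have "append_cols A' Bb = ?I\<^sup>T * ?N"
    unfolding embed_mat_transpose_mult[OF N id] A' Bb append_rows_def append_cols_def using p
    by (intro eq_matI) (auto simp: principal_sub_def)
  also have "\<dots> = (?T * ?I)\<^sup>T * M * ?T"
    unfolding NT using carrier_matD[OF M]
    by (simp add: mult_assoc_dim transpose_mult[of _ n n _ p] del: assoc_mult_mat)
  finally have row: "append_cols A' Bb = ?J\<^sup>T * M * ?T" unfolding TI .
  have MJ: "M * ?J \<in> carrier_mat n p" using M by (simp add: mult_carrier_mat[of _ n n _ p])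
  have JM: "?J\<^sup>T * M \<in> carrier_mat p n" using M by (simp add: mult_carrier_mat[of _ p n _ n])
  have "pseudo_skeleton p p M ?T\<^sup>T ?T\<^sup>T = ?T * (?T\<^sup>T * (M * ?J)) * B * (?J\<^sup>T * M * ?T) * ?T\<^sup>T"
    unfolding pseudo_skeleton_def permuted_blocks_def permuted_eq_principal_sub[OF M \<pi>] blocks
    using col row moore_penrose_eq_inverse[OF principal_sub_carrier B AB BA] by (simp add: A')
  also have "\<dots> = (?T * ?T\<^sup>T) * (M * ?J) * B * (?J\<^sup>T * M) * (?T * ?T\<^sup>T)"
    using carrier_matD[OF B] carrier_matD[OF M]
    by (simp add: mult_assoc_dim del: assoc_mult_mat)
  also have "\<dots> = (M * ?J) * B * (?J\<^sup>T * M)"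
    unfolding TT using MJ JM B by (simp add: mult_carrier_mat[of _ n p _ n] mult_carrier_mat[of _ n p _ p] 
        left_mult_one_mat[of _ n p] right_mult_one_mat[of _ n n] del: assoc_mult_mat)
  also have "\<dots> = M * (?J * B * ?J\<^sup>T) * M"
    using carrier_matD[OF B] carrier_matD[OF M]
    by (simp add: mult_assoc_dim del: assoc_mult_mat)
  finally show ?thesis .
qed

text \<open>The truncated diagonal is an invertible \<open>r\<close> by \<open>r\<close> diagonal
  matrix framed by coordinate embeddings, which exhibits a full-rank factorization with explicit
  one-sided inverses.\<close>

lemma rank_truncated:
  fixes d :: "nat \<Rightarrow> real"
  assumes U: "orthonormal_mat n U" and V: "orthonormal_mat n V" and r: "r \<le> n"
    and d: "\<And>i. i < r \<Longrightarrow> d i \<noteq> 0"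
  shows "vec_space.rank n (U * mat_diag n (\<lambda>i. if i < r then d i else 0) * V\<^sup>T) = r"
proof -
  let ?I = "embed_mat n r id" and ?D = "mat_diag r d" and ?R = "mat_diag r (\<lambda>i. 1 / d i)"
  note u = orthonormal_matD[OF U] and v = orthonormal_matD[OF V]
  note dims = carrier_matD[OF u(1)] carrier_matD[OF v(1)]
    carrier_matD[OF mat_diag_dim[of r d]] carrier_matD[OF mat_diag_dim[of r "\<lambda>i. 1 / d i"]]
  have id: "id \<in> {..<r} \<rightarrow> {..<n}" using r by auto
  have II: "?I\<^sup>T * ?I = 1\<^sub>m r" by (rule embed_mat_isometry[OF id]) simp
  have DR: "?D * ?R = 1\<^sub>m r"
    unfolding mat_diag_diag by (rule eq_matI) (auto simp: mat_diag_def d)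
  have diag: "mat_diag n (\<lambda>i. if i < r then d i else 0) = ?I * ?D * ?I\<^sup>T"
  proof (rule eq_matI)
    fix i l assume "i < dim_row (?I * ?D * ?I\<^sup>T)" "l < dim_col (?I * ?D * ?I\<^sup>T)"
    then have il: "i < n" "l < n" by auto
    have "(?I * ?D * ?I\<^sup>T) $$ (i,l)
        = (\<Sum>j<r. (if i = j then 1 else 0) * d j * (if l = j then 1 else 0))"
      using il by (simp add: mat_diag_mult_right[OF embed_mat_carrier] scalar_prod_def
          atLeast0LessThan) (simp add: embed_mat_def)
    also have "\<dots> = (\<Sum>j<r. if j = i then (if i = l then d i else 0) else 0)"
      by (intro sum.cong) auto
    finally show "mat_diag n (\<lambda>i. if i < r then d i else 0) $$ (i,l) = (?I * ?D * ?I\<^sup>T) $$ (i,l)"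
      using il by (simp add: mat_diag_def)
  qed (auto simp: mat_diag_def)
  have "U * mat_diag n (\<lambda>i. if i < r then d i else 0) * V\<^sup>T = (U * ?I) * (?D * (?I\<^sup>T * V\<^sup>T))"
    unfolding diag using dims by (simp add: mult_assoc_dim del: assoc_mult_mat)
  moreover have "vec_space.rank n ((U * ?I) * (?D * (?I\<^sup>T * V\<^sup>T))) = r"
  proof (rule rank_full_factorization[where L = "?I\<^sup>T * U\<^sup>T" and R = "V * ?I * ?R"])
    show "U * ?I \<in> carrier_mat n r" "?D * (?I\<^sup>T * V\<^sup>T) \<in> carrier_mat r n"
      "?I\<^sup>T * U\<^sup>T \<in> carrier_mat r n" "V * ?I * ?R \<in> carrier_mat n r"
      using dims by (auto intro: carrier_matI)
    have "(?I\<^sup>T * U\<^sup>T) * (U * ?I) = ?I\<^sup>T * ((U\<^sup>T * U) * ?I)"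
      using dims by (simp add: mult_assoc_dim del: assoc_mult_mat)
    then show "(?I\<^sup>T * U\<^sup>T) * (U * ?I) = 1\<^sub>m r" unfolding u(2) using II by simp
    have "(?D * (?I\<^sup>T * V\<^sup>T)) * (V * ?I * ?R) = ?D * (?I\<^sup>T * ((V\<^sup>T * V) * (?I * ?R)))"
      using dims by (simp add: mult_assoc_dim del: assoc_mult_mat mat_diag_diag)
    also have "\<dots> = ?D * ((?I\<^sup>T * ?I) * ?R)"
      unfolding v(2) using dims by (simp add: mult_assoc_dim del: assoc_mult_mat mat_diag_diag)
    also have "\<dots> = 1\<^sub>m r" unfolding II using DR dims by (simp del: mat_diag_diag)
    finally show "(?D * (?I\<^sup>T * V\<^sup>T)) * (V * ?I * ?R) = 1\<^sub>m r" .
  qed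
  ultimately show ?thesis by simp
qed

lemma mat_rank_nonsingular:
  assumes "A \<in> carrier_mat p p" "det A \<noteq> 0"
  shows "mat_rank A = p"
  using vec_space.low_rank_det_zero[OF assms] assms(1) unfolding mat_rank_def by simp

text \<open>Every principal submatrix of a positive definite matrix is positive definite, so all
  candidates have rank \<open>p\<close> and their volume is their determinant. The competitor
  \<open>g\<close> is realized by one permutation \<open>\<tau>\<close> applied to rows and columns
  alike.\<close>

lemma max_volume_perms_det_max:
  assumes M: "M \<in> carrier_mat n n" and sym: "M\<^sup>T = M" and pd: "pos_def_mat M"
    and p: "p \<le> n" and \<pi>: "\<pi> permutes {0..<n}"
    and max: "max_volume_perms p p M (embed_mat n n \<pi>)\<^sup>T (embed_mat n n \<pi>)\<^sup>T"
    and g: "g \<in> {..<p} \<rightarrow> {..<n}" "inj_on g {..<p}"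
  shows "det (principal_sub p g M) \<le> det (principal_sub p \<pi> M)"
proof -
  have *: "mat_rank (principal_sub p h M) = p \<and> vol p (principal_sub p h M) = det (principal_sub p h M)"
    if h: "h \<in> {..<p} \<rightarrow> {..<n}" "inj_on h {..<p}" for h
  proof -
    let ?A = "principal_sub p h M"
    have symA: "?A\<^sup>T = ?A" by (rule principal_sub_symmetric[OF M sym h(1)])
    have pdA: "pos_def_mat ?A" by (rule principal_sub_pos_def[OF M pd h])
    show ?thesis
      using pos_def_det_pos[OF principal_sub_carrier symA pdA]
        mat_rank_nonsingular[OF principal_sub_carrier, of p h M]
        vol_eq_det[OF principal_sub_carrier symA pos_def_imp_psd[OF principal_sub_carrier pdA]]
      by simp
  qed
  obtain \<tau> where \<tau>: "\<tau> permutes {0..<n}" "\<And>j. j < p \<Longrightarrow> \<tau> j = g j"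
    using inj_extends_to_permutation[OF g p] by metis
  have \<tau>g: "principal_sub p \<tau> M = principal_sub p g M"
    unfolding principal_sub_def by (intro eq_matI) (auto simp: \<tau>(2))
  have perm: "permutation_mat (dim_row M) (embed_mat n n \<tau>)\<^sup>T" "permutation_mat (dim_col M) (embed_mat n n \<tau>)\<^sup>T"
    using M \<tau>(1) permutation_mat_embed by auto
  have \<pi>p: "\<pi> \<in> {..<p} \<rightarrow> {..<n}" "inj_on \<pi> {..<p}"
    using permutes_Pi[OF \<pi> p] permutes_inj_on_initial[OF \<pi>] by auto
  show ?thesis
    using max[unfolded max_volume_perms_def Let_def, THEN conjunct2, THEN conjunct2, rule_format, OF conjI[OF perm]]
      *[OF g] *[OF \<pi>p]
    by (simp add: lead_block_eq_principal_sub[OF M \<pi> p] lead_block_eq_principal_sub[OF M \<tau>(1) p] \<tau>g)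
qed

lemma rect_diag_mat_square: "rect_diag_mat n n d = mat_diag n (\<lambda>i. d (i + 1))"
  unfolding rect_diag_mat_def mat_diag_def by (intro eq_matI) auto

lemma chebyshev_norm_le:
  assumes "X \<in> carrier_mat m n" "0 < m" "0 < n"
    and "\<And>i j. i < m \<Longrightarrow> j < n \<Longrightarrow> \<bar>X $$ (i,j)\<bar> \<le> c"
  shows "chebyshev_norm X \<le> c"
proof -
  have "X $$ (0,0) \<in> elements_mat X" using elements_matI[OF assms(1-3)] by simp
  moreover have "finite (elements_mat X)" unfolding elements_mat_def by simp
  ultimately show ?thesis
    unfolding chebyshev_norm_def using assms by (subst Max_le_iff) (auto dest!: elements_matD)
qed

theorem corollary2:
  fixes M Mh Mr :: "real mat" and n p r :: nat
  assumes "M \<in> carrier_mat n n"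
    and "symmetric_mat M"
    and "pos_def_mat M"
    and "1 \<le> r" and "r < p" and "p \<le> n - 1"
    and "is_principal_max_volume_approx p M Mh"
    and "is_truncated_svd r Mh Mr"
  shows "chebyshev_norm (Mr - M)
           \<le> (zeta p M * (eigval M (p + 1) / eigval M (r + 1)) + 1) * eigval M (r + 1)
         \<and> mat_rank Mr = r"
proof -
  note M = assms(1)
  have sym: "M\<^sup>T = M" using assms(2) unfolding symmetric_mat_def by simp
  have pn: "p < n" "r < n" using assms(4-6) by auto
  obtain P where P: "max_volume_perms p p M P P" and MhP: "Mh = pseudo_skeleton p p M P P"
    using assms(7) unfolding is_principal_max_volume_approx_def by blast
  obtain \<pi> where \<pi>: "\<pi> permutes {0..<n}" and P\<pi>: "P = (embed_mat n n \<pi>)\<^sup>T"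
    using P M permutation_mat_embed unfolding max_volume_perms_def by auto
  have \<pi>p: "\<pi> \<in> {..<p} \<rightarrow> {..<n}" "inj_on \<pi> {..<p}"
    using permutes_Pi[OF \<pi>] pn permutes_inj_on_initial[OF \<pi>] by auto
  let ?A = "principal_sub p \<pi> M"
  have symA: "?A\<^sup>T = ?A" by (rule principal_sub_symmetric[OF M sym \<pi>p(1)])
  have pdA: "pos_def_mat ?A" by (rule principal_sub_pos_def[OF M assms(3) \<pi>p])
  obtain B where B: "B \<in> carrier_mat p p" "?A * B = 1\<^sub>m p" "B * ?A = 1\<^sub>m p"
    using inverse_mat_exists[OF principal_sub_carrier, of p \<pi> M]
      pos_def_det_pos[OF principal_sub_carrier symA pdA] by (metis less_irrefl)
  interpret skel: principal_skeleton M n p \<pi> B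
    using M sym assms(3) \<pi>p B by unfold_locales
  have MhS: "Mh = skel.S"
    unfolding MhP P\<pi> skel.S_def skel.Q_def using pn by (intro pseudo_skeleton_eq[OF M \<pi> _ B]) simp_all
  note Mh = skel.S[folded MhS] and Mh_psd = skel.S_psd[folded MhS]
  have detmax: "det (principal_sub p g M) \<le> det ?A"
    if "g \<in> {..<p} \<rightarrow> {..<n}" "inj_on g {..<p}" for g
    using that pn P unfolding P\<pi> by (intro max_volume_perms_det_max[OF M sym assms(3) _ \<pi>]) auto
  let ?h = "real (p + 1) / (\<Sum>k=1..p+1. inverse (eigval M k))"
  have error: "\<bar>M $$ (i,j) - Mh $$ (i,j)\<bar> \<le> ?h" if "i < n" "j < n" for i j
    using skel.E_entry_le[OF detmax pn(1) that] that M Mh(1) unfolding skel.E_def MhS by simp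
  have sv: "singval Mh k = eigval Mh k" if "1 \<le> k" "k \<le> n" for k
    by (rule singval_eq_eigval[OF Mh that Mh_psd])
  \<comment> \<open>The compression is taken along the identity, which gives Weyl monotonicity for
    \<open>S\<close> below \<open>M\<close>.\<close>
  have sv_le: "eigval Mh (r + 1) \<le> eigval M (r + 1)"
    by (rule eigval_compression_le[OF M sym Mh one_carrier_mat])
      (use pn skel.S_le M Mh in \<open>auto simp: MhS\<close>)
  \<comment> \<open>Here \<open>r < p\<close> enters: the compression of \<open>Mh\<close> to the
    selected indices is the positive definite \<open>?A\<close>, which has an eigenvalue of each
    index \<open>k\<close> up to \<open>r\<close>.\<close>
  have sv_pos: "0 < eigval Mh k" if k: "1 \<le> k" "k \<le> r" for k
  proof -
    have "0 < eigval ?A k"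
      by (rule eigval_pos[OF principal_sub_carrier symA _ _ pdA]) (use k assms(5) in auto)
    also have "eigval ?A k \<le> eigval Mh k"
      by (rule eigval_compression_le[OF Mh principal_sub_carrier symA skel.J embed_mat_isometry[OF \<pi>p]])
        (use k assms(5) pn conj_quadratic_form[OF Mh(1) skel.J] skel.principal_sub_S in \<open>auto simp: MhS\<close>)
    finally show ?thesis .
  qed
  obtain U V where UV: "is_svd Mh U V"
    and MrUV: "Mr = U * rect_diag_mat (dim_row Mh) (dim_col Mh) (\<lambda>i. if i \<le> r then singval Mh i else 0) * V\<^sup>T"
    using assms(8) unfolding is_truncated_svd_def by blast
  have U: "orthonormal_mat n U" and V: "orthonormal_mat n V"
    and MhUV: "Mh = U * mat_diag n (\<lambda>i. singval Mh (i + 1)) * V\<^sup>T"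
    using UV Mh(1) unfolding is_svd_def by (auto simp: rect_diag_mat_square)
  note u = orthonormal_matD[OF U] and v = orthonormal_matD[OF V]
  \<comment> \<open>The condition \<open>i \<le> r\<close> on indices from 1 becomes
    \<open>i < r\<close> on indices from 0.\<close>
  have MrUV': "Mr = U * mat_diag n (\<lambda>i. if i < r then singval Mh (i + 1) else 0) * V\<^sup>T"
    using MrUV Mh(1) by (simp add: rect_diag_mat_square Suc_le_eq)
  have Mr: "Mr \<in> carrier_mat n n"
    unfolding MrUV' using carrier_matD[OF u(1)] carrier_matD[OF v(1)] by (auto intro: carrier_matI)
  have rank: "mat_rank Mr = r"
    using rank_truncated[OF U V, of r "\<lambda>i. singval Mh (i + 1)"] sv sv_pos pn Mr
    unfolding mat_rank_def MrUV'[symmetric] by (auto simp: less_imp_neq[symmetric])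
  \<comment> \<open>\<open>Mr\<close> and \<open>Mh\<close> share both orthogonal factors, so in
    their difference the first \<open>r\<close> singular values cancel and only the discarded ones
    remain, negated.\<close>
  let ?D = "mat_diag n (\<lambda>i. if i < r then singval Mh (i + 1) else 0)"
    and ?F = "mat_diag n (\<lambda>i. singval Mh (i + 1))"
    and ?T = "mat_diag n (\<lambda>i. if i < r then 0 else - singval Mh (i + 1))"
  have "Mr - Mh = (U * ?D - U * ?F) * V\<^sup>T"
    using u(1) v(1) by (subst MhUV, subst MrUV') (simp add: minus_mult_distrib_mat[of _ n n])
  also have "U * ?D - U * ?F = U * (?D - ?F)"
    by (rule mult_minus_distrib_mat[symmetric, OF u(1) mat_diag_dim mat_diag_dim])
  also have "?D - ?F = ?T" by (intro eq_matI) (auto simp: mat_diag_def)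
  finally have diff: "Mr - Mh = U * ?T * V\<^sup>T" .
  have trunc: "\<bar>Mr $$ (i,j) - Mh $$ (i,j)\<bar> \<le> eigval M (r + 1)" if ij: "i < n" "j < n" for i j
  proof -
    have "\<bar>(U * ?T * V\<^sup>T) $$ (i,j)\<bar> \<le> eigval Mh (r + 1)"
    proof (rule orthonormal_diag_entry_le[OF U V _ ij])
      fix k assume "k < n"
      then show "\<bar>if k < r then 0 else - singval Mh (k + 1)\<bar> \<le> eigval Mh (r + 1)"
        using sv[of "k + 1"] eigval_nonneg[OF Mh, of "k + 1"] eigval_nonneg[OF Mh, of "r + 1"]
          eigval_antimono[OF Mh, of "r + 1" "k + 1"] pn Mh_psd by auto
    qed
    then show ?thesis using sv_le ij Mr Mh(1) unfolding diff[symmetric] by simp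
  qed
  have "chebyshev_norm (Mr - M) \<le> ?h + eigval M (r + 1)"
  proof (rule chebyshev_norm_le)
    fix i j assume ij: "i < n" "j < n"
    then have "(Mr - M) $$ (i,j) = (Mr $$ (i,j) - Mh $$ (i,j)) - (M $$ (i,j) - Mh $$ (i,j))"
      using M Mr by simp
    then show "\<bar>(Mr - M) $$ (i,j)\<bar> \<le> ?h + eigval M (r + 1)"
      using trunc[OF ij] error[OF ij] by linarith
  qed (use M Mr pn in auto)
  also have "?h + eigval M (r + 1)
      = (zeta p M * (eigval M (p + 1) / eigval M (r + 1)) + 1) * eigval M (r + 1)"
  proof -
    have "0 < eigval M (p + 1)" "0 < eigval M (r + 1)"
      using pn by (auto intro!: eigval_pos[OF M sym _ _ assms(3)])
    then have zeta: "zeta p M * eigval M (p + 1) = ?h" and "eigval M (r + 1) \<noteq> 0"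
      unfolding zeta_def by simp_all
    \<comment> \<open>The factor \<open>eigval M (r + 1)\<close> cancels its own denominator,
      leaving the harmonic mean plus the truncation error.\<close>
    have "(z * (a / b) + 1) * b = z * a + b" if "b \<noteq> 0" for z a b :: real
      using that by (simp add: distrib_right)
    from this[OF \<open>eigval M (r + 1) \<noteq> 0\<close>] show ?thesis unfolding zeta[symmetric] ..
  qed
  finally show ?thesis using rank by blast
qed

end
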